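(* Let $V=\bigoplus_{d=0}^\infty V_d$ be a simple vertex operator algebra of CFT type. Then $D(x,y)$ is finite dimensional for any $x,y\in V$.
   Context: All vertex operator algebras (VOAs) are over $\mathbb{C}$, $a_{(n)}b$ ($n\in\mathbb{Z}$) denotes the $n$-th product, $\mathbf{1}$ the vacuum vector, and $V_d$ is the eigenspace of $L_0$ with eigenvalue $d$. A VOA $V=\bigoplus_d V_d$ is of CFT type if $V_d=0$ for $d<0$ and $V_0=\mathbb{C}\mathbf{1}$. For a VOA $U$, $C_2(U)$ is the linear span of all $a_{(-2)}b$ with $a,b\in U$, and $R(U)=U/C_2(U)$. $T^2(V)=V\otimes V$ is the tensor product VOA, on which $S_2$ acts by permuting the factors, and $T^2(V)^{S_2}$ is the fixed-point vertex operator subalgebra. Define $\eta:V\to T^2(V)^{S_2}$ by $\eta(a)=a\otimes\mathbf{1}+\mathbf{1}\otimes a$ and let $\overline{\eta}(a)=\eta(a)+C_2(T^2(V)^{S_2})\in R(T^2(V)^{S_2})$. For $x,y\in V$, $D(x,y)$ is the linear span of $\{\overline{\eta}(x_{(-n)}y)\mid n\in\mathbb{Z}_{>0}\}$ in $R(T^2(V)^{S_2})$. *)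

theory Defs
  imports Complex_Main "HOL-Library.Poly_Mapping" "HOL-Library.Groups_Big_Fun"
begin

section \<open>Complex vector spaces\<close>

class complex_vector = ab_group_add +
  fixes scaleC :: "complex \<Rightarrow> 'a \<Rightarrow> 'a"  (infixr \<open>*\<^sub>C\<close> 75)
  assumes scaleC_add_right: "a *\<^sub>C (x + y) = a *\<^sub>C x + a *\<^sub>C y"
    and scaleC_add_left: "(a + b) *\<^sub>C x = a *\<^sub>C x + b *\<^sub>C x"
    and scaleC_scaleC: "a *\<^sub>C b *\<^sub>C x = (a * b) *\<^sub>C x"
    and scaleC_one: "1 *\<^sub>C x = x"

global_interpretation cvec: vector_space "scaleC :: complex \<Rightarrow> 'a \<Rightarrow> 'a::complex_vector"
  defines cspan = cvec.span and csubspace = cvec.subspace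
  by unfold_locales (simp_all add: scaleC_add_right scaleC_add_left scaleC_scaleC scaleC_one)

abbreviation clinear :: "('a::complex_vector \<Rightarrow> 'b::complex_vector) \<Rightarrow> bool"
  where "clinear \<equiv> Vector_Spaces.linear scaleC scaleC"

definition cbilinear ::
  "('a::complex_vector \<Rightarrow> 'b::complex_vector \<Rightarrow> 'c::complex_vector) \<Rightarrow> bool"
  where "cbilinear f \<longleftrightarrow> (\<forall>x. clinear (f x)) \<and> (\<forall>y. clinear (\<lambda>x. f x y))"

lemma clinearI:
  "(\<And>x y. f (x + y) = f x + f y) \<Longrightarrow> (\<And>c x. f (c *\<^sub>C x) = c *\<^sub>C f x) \<Longrightarrow> clinear f"
  by (simp add: Vector_Spaces.linear_iff cvec.vector_space_axioms)

lemma clinear_add: "clinear f \<Longrightarrow> f (x + y) = f x + f y"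
  and clinear_scale: "clinear f \<Longrightarrow> f (c *\<^sub>C x) = c *\<^sub>C f x"
  by (simp_all add: Vector_Spaces.linear_iff)

lemma clinear_0: "clinear f \<Longrightarrow> f 0 = 0"
  using clinear_add[of f 0 0] by simp

lemma cbilinearI:
  assumes "\<And>x y z. f (x + y) z = f x z + f y z" "\<And>c x z. f (c *\<^sub>C x) z = c *\<^sub>C f x z"
    "\<And>x y z. f x (y + z) = f x y + f x z" "\<And>c x y. f x (c *\<^sub>C y) = c *\<^sub>C f x y"
  shows "cbilinear f"
  using assms by (auto simp: cbilinear_def intro!: clinearI)

lemma cbilinear_add_left: "cbilinear f \<Longrightarrow> f (x + y) z = f x z + f y z"
  and cbilinear_add_right: "cbilinear f \<Longrightarrow> f x (z + w) = f x z + f x w"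
  and cbilinear_scale_left: "cbilinear f \<Longrightarrow> f (c *\<^sub>C x) z = c *\<^sub>C f x z"
  and cbilinear_scale_right: "cbilinear f \<Longrightarrow> f x (c *\<^sub>C z) = c *\<^sub>C f x z"
  by (auto simp: cbilinear_def Vector_Spaces.linear_iff)

lemma clinear_eq_on_span:
  assumes "clinear f" "clinear g" "\<And>x. x \<in> S \<Longrightarrow> f x = g x" "x \<in> cspan S"
  shows "f x = g x"
  using assms(4)
  by (induction rule: cvec.span_induct_alt)
     (simp_all add: assms clinear_add clinear_scale clinear_0)

section \<open>Tensor products\<close>

text \<open>The free complex vector space on \<open>A \<times> B\<close> is \<open>('a \<times> 'b) \<Rightarrow>\<^sub>0 complex\<close>; the tensor product
  is its quotient by the span of the bilinearity relations.\<close>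

definition free_scale :: "complex \<Rightarrow> ('k \<Rightarrow>\<^sub>0 complex) \<Rightarrow> ('k \<Rightarrow>\<^sub>0 complex)"
  where "free_scale c = Poly_Mapping.map ((*) c)"

lemma lookup_free_scale [simp]: "Poly_Mapping.lookup (free_scale c p) k = c * Poly_Mapping.lookup p k"
  by (simp add: free_scale_def Poly_Mapping.map.rep_eq when_def)

interpretation free: vector_space free_scale
  by unfold_locales (auto intro!: poly_mapping_eqI simp: lookup_add algebra_simps)

abbreviation free_gen :: "'a \<Rightarrow> 'b \<Rightarrow> ('a \<times> 'b) \<Rightarrow>\<^sub>0 complex"
  where "free_gen x y \<equiv> Poly_Mapping.single (x, y) 1"

definition tensor_relators :: "(('a::complex_vector \<times> 'b::complex_vector) \<Rightarrow>\<^sub>0 complex) set"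
  where "tensor_relators =
      {free_gen (x + x') y - free_gen x y - free_gen x' y | x x' y. True}
    \<union> {free_gen x (y + y') - free_gen x y - free_gen x y' | x y y'. True}
    \<union> {free_gen (c *\<^sub>C x) y - free_scale c (free_gen x y) | c x y. True}
    \<union> {free_gen x (c *\<^sub>C y) - free_scale c (free_gen x y) | c x y. True}"

definition tensor_rel ::
  "('a::complex_vector \<times> 'b::complex_vector \<Rightarrow>\<^sub>0 complex) \<Rightarrow> ('a \<times> 'b \<Rightarrow>\<^sub>0 complex) \<Rightarrow> bool"
  where "tensor_rel p q \<longleftrightarrow> p - q \<in> free.span tensor_relators"

lemma tensor_rel_equivp:
  "equivp (tensor_rel :: ('a::complex_vector \<times> 'b::complex_vector \<Rightarrow>\<^sub>0 complex) \<Rightarrow> _)"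
proof (rule equivpI)
  show "reflp (tensor_rel :: ('a \<times> 'b \<Rightarrow>\<^sub>0 complex) \<Rightarrow> _)"
    by (simp add: reflp_def tensor_rel_def free.span_zero)
  show "symp (tensor_rel :: ('a \<times> 'b \<Rightarrow>\<^sub>0 complex) \<Rightarrow> _)"
    unfolding symp_def tensor_rel_def by (metis free.span_neg minus_diff_eq)
  show "transp (tensor_rel :: ('a \<times> 'b \<Rightarrow>\<^sub>0 complex) \<Rightarrow> _)"
  proof (rule transpI)
    fix p q r :: "('a \<times> 'b) \<Rightarrow>\<^sub>0 complex"
    assume "tensor_rel p q" "tensor_rel q r"
    then have "(p - q) + (q - r) \<in> free.span tensor_relators"
      unfolding tensor_rel_def by (rule free.span_add)
    then show "tensor_rel p r" by (simp add: tensor_rel_def)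
  qed
qed

quotient_type (overloaded) ('a, 'b) tensor =
    "('a::complex_vector \<times> 'b::complex_vector) \<Rightarrow>\<^sub>0 complex" / tensor_rel
  by (rule tensor_rel_equivp)

instantiation tensor :: (complex_vector, complex_vector) complex_vector
begin

lift_definition zero_tensor :: "('a, 'b) tensor" is 0 .

lift_definition plus_tensor :: "('a, 'b) tensor \<Rightarrow> ('a, 'b) tensor \<Rightarrow> ('a, 'b) tensor" is "(+)"
proof -
  fix p q r s :: "('a \<times> 'b) \<Rightarrow>\<^sub>0 complex"
  assume "tensor_rel p q" "tensor_rel r s"
  then have "(p - q) + (r - s) \<in> free.span tensor_relators"
    unfolding tensor_rel_def by (rule free.span_add)
  then show "tensor_rel (p + r) (q + s)"
    by (simp add: tensor_rel_def algebra_simps)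
qed

lift_definition uminus_tensor :: "('a, 'b) tensor \<Rightarrow> ('a, 'b) tensor" is uminus
  unfolding tensor_rel_def by (metis free.span_neg minus_diff_minus)

lift_definition minus_tensor :: "('a, 'b) tensor \<Rightarrow> ('a, 'b) tensor \<Rightarrow> ('a, 'b) tensor" is "(-)"
proof -
  fix p q r s :: "('a \<times> 'b) \<Rightarrow>\<^sub>0 complex"
  assume "tensor_rel p q" "tensor_rel r s"
  then have "(p - q) - (r - s) \<in> free.span tensor_relators"
    unfolding tensor_rel_def by (rule free.span_diff)
  then show "tensor_rel (p - r) (q - s)"
    by (simp add: tensor_rel_def algebra_simps)
qed

lift_definition scaleC_tensor :: "complex \<Rightarrow> ('a, 'b) tensor \<Rightarrow> ('a, 'b) tensor" is free_scale
  unfolding tensor_rel_def by (metis free.span_scale free.scale_right_diff_distrib)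

instance
proof
  fix a b c :: "('a, 'b) tensor" and s t :: complex
  have r: "tensor_rel p p" for p :: "'a \<times> 'b \<Rightarrow>\<^sub>0 complex"
    by (simp add: tensor_rel_def free.span_zero)
  show "a + b + c = a + (b + c)" by transfer (simp add: r add.assoc)
  show "a + b = b + a" by transfer (simp add: r add.commute)
  show "0 + a = a" by transfer (simp add: r)
  show "- a + a = 0" by transfer (simp add: r)
  show "a - b = a + - b" by transfer (simp add: r)
  show "s *\<^sub>C (a + b) = s *\<^sub>C a + s *\<^sub>C b"
    by transfer (simp add: r free.scale_right_distrib)
  show "(s + t) *\<^sub>C a = s *\<^sub>C a + t *\<^sub>C a"
    by transfer (simp add: r free.scale_left_distrib)
  show "s *\<^sub>C t *\<^sub>C a = (s * t) *\<^sub>C a" by transfer (simp add: r)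
  show "1 *\<^sub>C a = a" by transfer (simp add: r)
qed

end

lift_definition pure_tensor ::
  "'a::complex_vector \<Rightarrow> 'b::complex_vector \<Rightarrow> ('a, 'b) tensor"  (infixr \<open>\<otimes>\<close> 76)
  is free_gen .

lemma tensor_rel_base: "p - q \<in> tensor_relators \<Longrightarrow> tensor_rel p q"
  by (simp add: tensor_rel_def free.span_base)

lemma cbilinear_pure_tensor: "cbilinear (\<otimes>)"
proof (rule cbilinearI)
  show "(x + y) \<otimes> z = x \<otimes> z + y \<otimes> z" for x y :: 'a and z :: 'b
    by transfer (rule tensor_rel_base, unfold tensor_relators_def diff_diff_eq, blast)
  show "(c *\<^sub>C x) \<otimes> z = c *\<^sub>C (x \<otimes> z)" for c and x :: 'a and z :: 'b
    by transfer (rule tensor_rel_base, unfold tensor_relators_def, blast)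
  show "x \<otimes> (y + z) = x \<otimes> y + x \<otimes> z" for x :: 'a and y z :: 'b
    by transfer (rule tensor_rel_base, unfold tensor_relators_def diff_diff_eq, blast)
  show "x \<otimes> (c *\<^sub>C z) = c *\<^sub>C (x \<otimes> z)" for c and x :: 'a and z :: 'b
    by transfer (rule tensor_rel_base, unfold tensor_relators_def, blast)
qed

lemma cspan_pure_tensors: "u \<in> cspan {x \<otimes> y | x y. True}"
proof (induction u rule: tensor.abs_induct)
  fix p :: "'a \<times> 'b \<Rightarrow>\<^sub>0 complex"
  have eq: "p = (\<Sum>k\<in>Poly_Mapping.keys p. Poly_Mapping.single k (Poly_Mapping.lookup p k))"
    by (rule poly_mapping_eqI)
       (simp add: lookup_sum lookup_single when_def sum.delta in_keys_iff)
  have single: "abs_tensor (Poly_Mapping.single (x, y) v) = v *\<^sub>C (x \<otimes> y)" for x :: 'a and y :: 'b and v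
    by (simp add: pure_tensor.abs_eq scaleC_tensor.abs_eq free_scale_def)
  have "abs_tensor (\<Sum>k\<in>A. Poly_Mapping.single k (f k)) \<in> cspan {x \<otimes> y | x y. True}"
    for f and A :: "('a \<times> 'b) set"
  proof (induction A rule: infinite_finite_induct)
    case (insert k A)
    have "abs_tensor (Poly_Mapping.single k (f k)) \<in> cspan {x \<otimes> y | x y. True}"
      by (cases k) (auto simp: single intro: cvec.span_scale[OF cvec.span_base])
    with insert show ?case
      by (simp add: plus_tensor.abs_eq[symmetric] cvec.span_add)
  qed (simp_all add: zero_tensor.abs_eq[symmetric] cvec.span_zero)
  then show "abs_tensor p \<in> cspan {x \<otimes> y | x y. True}"
    by (subst eq)
qed

text \<open>The linear map on the tensor product induced by a bilinear \<open>f\<close>. It is computed on an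
  arbitrary representative; \<open>tensor_lift_pure\<close> and \<open>clinear_tensor_lift\<close> below show that the
  choice is immaterial for bilinear \<open>f\<close>.\<close>

definition free_eval :: "('a \<Rightarrow> 'b \<Rightarrow> 'c::complex_vector) \<Rightarrow> ('a \<times> 'b \<Rightarrow>\<^sub>0 complex) \<Rightarrow> 'c"
  where "free_eval f p = (\<Sum>(x, y)\<in>Poly_Mapping.keys p. Poly_Mapping.lookup p (x, y) *\<^sub>C f x y)"

definition tensor_lift ::
  "('a::complex_vector \<Rightarrow> 'b::complex_vector \<Rightarrow> 'c::complex_vector) \<Rightarrow> ('a, 'b) tensor \<Rightarrow> 'c"
  where "tensor_lift f u = free_eval f (rep_tensor u)"

lemma free_eval_superset:
  assumes "finite A" "Poly_Mapping.keys p \<subseteq> A"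
  shows "free_eval f p = (\<Sum>(x, y)\<in>A. Poly_Mapping.lookup p (x, y) *\<^sub>C f x y)"
  unfolding free_eval_def
  by (rule sum.mono_neutral_left) (use assms in \<open>auto simp: in_keys_iff\<close>)

lemma free_eval_add: "free_eval f (p + q) = free_eval f p + free_eval f q"
proof -
  have "Poly_Mapping.keys (p + q) \<subseteq> Poly_Mapping.keys p \<union> Poly_Mapping.keys q" by (rule Poly_Mapping.keys_add)
  then show ?thesis
    by (simp add: free_eval_superset[of "Poly_Mapping.keys p \<union> Poly_Mapping.keys q"] sum.distrib[symmetric]
        lookup_add cvec.scale_left_distrib split_beta)
qed

lemma free_eval_scale: "free_eval f (free_scale c p) = c *\<^sub>C free_eval f p"
proof -
  have "Poly_Mapping.keys (free_scale c p) \<subseteq> Poly_Mapping.keys p" by (auto simp: in_keys_iff)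
  then show ?thesis
    by (simp add: free_eval_superset[of "Poly_Mapping.keys p"] cvec.scale_sum_right split_beta)
qed

lemma free_eval_gen [simp]: "free_eval f (free_gen x y) = f x y"
  by (simp add: free_eval_def)

lemma free_eval_diff: "free_eval f (p - q) = free_eval f p - free_eval f q"
  by (metis add_diff_cancel diff_add_cancel free_eval_add)

lemma free_eval_rel:
  assumes "cbilinear f" "tensor_rel p q"
  shows "free_eval f p = free_eval f q"
proof -
  have "free_eval f r = 0" if "r \<in> free.span tensor_relators" for r
    using that
  proof (induction rule: free.span_induct_alt)
    case base
    show ?case by (simp add: free_eval_def)
  next
    case (step c s r)
    have "free_eval f s = 0"
      using step(1) unfolding tensor_relators_def
      by (auto simp: free_eval_diff free_eval_scale cbilinear_add_left[OF assms(1)]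
          cbilinear_add_right[OF assms(1)] cbilinear_scale_left[OF assms(1)]
          cbilinear_scale_right[OF assms(1)])
    with step show ?case by (simp add: free_eval_add free_eval_scale)
  qed
  from this[of "p - q"] assms(2) show ?thesis
    by (simp add: tensor_rel_def free_eval_diff)
qed

lemma tensor_lift_abs: "cbilinear f \<Longrightarrow> tensor_lift f (abs_tensor p) = free_eval f p"
  unfolding tensor_lift_def
  by (rule free_eval_rel) (auto intro: Quotient3_rep_abs[OF Quotient3_tensor] 
      equivp_reflp[OF tensor_rel_equivp])

lemma tensor_lift_pure: "cbilinear f \<Longrightarrow> tensor_lift f (x \<otimes> y) = f x y"
  by (simp add: pure_tensor.abs_eq tensor_lift_abs)

lemma clinear_tensor_lift:
  assumes "cbilinear f" shows "clinear (tensor_lift f)"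
proof (rule clinearI)
  show "tensor_lift f (u + v) = tensor_lift f u + tensor_lift f v" for u v
    by (induction u rule: tensor.abs_induct, induction v rule: tensor.abs_induct)
       (simp add: plus_tensor.abs_eq tensor_lift_abs assms free_eval_add)
  show "tensor_lift f (c *\<^sub>C u) = c *\<^sub>C tensor_lift f u" for c u
    by (induction u rule: tensor.abs_induct)
       (simp add: scaleC_tensor.abs_eq tensor_lift_abs assms free_eval_scale)
qed

lemma tensor_lift_add_fun:
  "tensor_lift (\<lambda>a b. f a b + g a b) u = tensor_lift f u + tensor_lift g u"
  by (simp add: tensor_lift_def free_eval_def sum.distrib split_beta cvec.scale_right_distrib)

lemma tensor_lift_scale_fun: "tensor_lift (\<lambda>a b. c *\<^sub>C f a b) u = c *\<^sub>C tensor_lift f u"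
  by (simp add: tensor_lift_def free_eval_def split_beta cvec.scale_sum_right mult.commute)

section \<open>Vertex operator algebras\<close>

text \<open>\<open>Y a n b\<close> is the \<open>n\<close>-th product of \<open>a\<close> and \<open>b\<close>, \<open>vac\<close> the vacuum and \<open>\<omega>\<close> the conformal
  vector, so that the Virasoro operator \<open>L\<^sub>m\<close> is \<open>Y \<omega> (m + 1)\<close>. By truncation all sums
  in the Borcherds identity have finite support, so \<open>Sum_any\<close> is the genuine sum.\<close>

definition weight_space ::
  "('v::complex_vector \<Rightarrow> int \<Rightarrow> 'v \<Rightarrow> 'v) \<Rightarrow> 'v \<Rightarrow> int \<Rightarrow> 'v set"
  where "weight_space Y \<omega> d = {v. Y \<omega> 1 v = of_int d *\<^sub>C v}"

locale vertex_operator_algebra =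
  fixes Y :: "'v::complex_vector \<Rightarrow> int \<Rightarrow> 'v \<Rightarrow> 'v"
    and vac :: 'v
    and \<omega> :: 'v
  assumes bilinear: "cbilinear (\<lambda>a b. Y a n b)"
    and truncation: "\<exists>N. \<forall>n\<ge>N. Y a n b = 0"
    and vacuum: "Y vac n a = (if n = - 1 then a else 0)"
    and creation: "n \<ge> 0 \<Longrightarrow> Y a n vac = 0" "Y a (- 1) vac = a"
    and borcherds:
      "Sum_any (\<lambda>i::nat. (of_int p gchoose i) *\<^sub>C Y (Y a (r + int i) b) (p + q - int i) c)
       = Sum_any (\<lambda>i::nat. ((- 1) ^ i * (of_int r gchoose i)) *\<^sub>C
           (Y a (p + r - int i) (Y b (q + int i) c)
            - ((- 1) powi r) *\<^sub>C Y b (q + r - int i) (Y a (p + int i) c)))"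
    and virasoro:
      "\<exists>central_charge. \<forall>m n v.
         Y \<omega> (m + 1) (Y \<omega> (n + 1) v) - Y \<omega> (n + 1) (Y \<omega> (m + 1) v)
         = of_int (m - n) *\<^sub>C Y \<omega> (m + n + 1) v
           + (if m + n = 0 then (of_int (m ^ 3 - m) / 12 * central_charge) *\<^sub>C v else 0)"
    and translation: "Y (Y \<omega> 0 a) n b = (- of_int n) *\<^sub>C Y a (n - 1) b"
      \<comment> \<open>the sum of the eigenspaces is automatically direct\<close>
    and grading: "cspan (\<Union>d. weight_space Y \<omega> d) = UNIV"
    and finite_dimensional: "\<exists>B. finite B \<and> weight_space Y \<omega> d \<subseteq> cspan B"
    and bounded_below: "\<exists>N. \<forall>d<N. weight_space Y \<omega> d = {0}"

definition CFT_type :: "('v::complex_vector \<Rightarrow> int \<Rightarrow> 'v \<Rightarrow> 'v) \<Rightarrow> 'v \<Rightarrow> 'v \<Rightarrow> bool"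
  where "CFT_type Y vac \<omega> \<longleftrightarrow>
    (\<forall>d<0. weight_space Y \<omega> d = {0}) \<and> weight_space Y \<omega> 0 = cspan {vac}"

definition vertex_ideal :: "('v::complex_vector \<Rightarrow> int \<Rightarrow> 'v \<Rightarrow> 'v) \<Rightarrow> 'v set \<Rightarrow> bool"
  where "vertex_ideal Y I \<longleftrightarrow>
    csubspace I \<and> (\<forall>a n. \<forall>u\<in>I. Y a n u \<in> I \<and> Y u n a \<in> I)"

definition simple_vertex_algebra :: "('v::complex_vector \<Rightarrow> int \<Rightarrow> 'v \<Rightarrow> 'v) \<Rightarrow> bool"
  where "simple_vertex_algebra Y \<longleftrightarrow>
    (UNIV :: 'v set) \<noteq> {0} \<and> (\<forall>I. vertex_ideal Y I \<longrightarrow> I = {0} \<or> I = UNIV)"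

section \<open>The tensor square and its fixed points\<close>

text \<open>\<open>(a \<otimes> b)\<^sub>(\<^sub>n\<^sub>) (c \<otimes> d) = \<Sum>\<^sub>i a\<^sub>(\<^sub>i\<^sub>) c \<otimes> b\<^sub>(\<^sub>n\<^sub>-\<^sub>1\<^sub>-\<^sub>i\<^sub>) d\<close>, the coefficient of \<open>z\<^bsup>-n-1\<^esup>\<close> in
  \<open>Y(a,z) c \<otimes> Y(b,z) d\<close>, extended bilinearly. \<open>C\<^sub>2\<close> and \<open>R\<close> depend only on the products, so the
  vacuum \<open>vac \<otimes> vac\<close> and conformal vector \<open>\<omega> \<otimes> vac + vac \<otimes> \<omega>\<close> do not enter.\<close>

definition tensor_square_prod_pure ::
  "('v::complex_vector \<Rightarrow> int \<Rightarrow> 'v \<Rightarrow> 'v) \<Rightarrow> int \<Rightarrow> 'v \<Rightarrow> 'v \<Rightarrow> 'v \<Rightarrow> 'v \<Rightarrow> ('v, 'v) tensor"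
  where "tensor_square_prod_pure Y n a b c d =
    Sum_any (\<lambda>i::int. Y a i c \<otimes> Y b (n - 1 - i) d)"

definition tensor_square_prod ::
  "('v::complex_vector \<Rightarrow> int \<Rightarrow> 'v \<Rightarrow> 'v) \<Rightarrow>
   ('v, 'v) tensor \<Rightarrow> int \<Rightarrow> ('v, 'v) tensor \<Rightarrow> ('v, 'v) tensor"
  where "tensor_square_prod Y u n w =
    tensor_lift (\<lambda>a b. tensor_lift (tensor_square_prod_pure Y n a b) w) u"

definition tensor_swap :: "('v::complex_vector, 'v) tensor \<Rightarrow> ('v, 'v) tensor"
  where "tensor_swap = tensor_lift (\<lambda>a b. b \<otimes> a)"

definition S2_fixed :: "('v::complex_vector, 'v) tensor set"
  where "S2_fixed = {u. tensor_swap u = u}"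

definition eta :: "'v::complex_vector \<Rightarrow> 'v \<Rightarrow> ('v, 'v) tensor"
  where "eta vac a = a \<otimes> vac + vac \<otimes> a"

section \<open>\<open>C\<^sub>2\<close> and the quotient \<open>R\<close>\<close>

text \<open>\<open>U\<close> is the underlying set of a vertex operator subalgebra of the ambient type.\<close>

definition C2 :: "'u::complex_vector set \<Rightarrow> ('u \<Rightarrow> int \<Rightarrow> 'u \<Rightarrow> 'u) \<Rightarrow> 'u set"
  where "C2 U Y = cspan {Y a (- 2) b | a b. a \<in> U \<and> b \<in> U}"

text \<open>Quotients by a subspace \<open>W\<close> are spaces of cosets, with the vector space operations
  induced from representatives.\<close>

definition coset :: "'u::complex_vector set \<Rightarrow> 'u \<Rightarrow> 'u set"
  where "coset W u = {u + w | w. w \<in> W}"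

definition coset_add :: "'u::complex_vector set \<Rightarrow> 'u set \<Rightarrow> 'u set"
  where "coset_add A B = {a + b | a b. a \<in> A \<and> b \<in> B}"

definition coset_scale :: "'u::complex_vector set \<Rightarrow> complex \<Rightarrow> 'u set \<Rightarrow> 'u set"
  where "coset_scale W c A = {c *\<^sub>C a + w | a w. a \<in> A \<and> w \<in> W}"

inductive_set quotient_span :: "'u::complex_vector set \<Rightarrow> 'u set set \<Rightarrow> 'u set set"
  for W :: "'u set" and S :: "'u set set"
  where
    zero: "coset W 0 \<in> quotient_span W S"
  | step: "A \<in> S \<Longrightarrow> B \<in> quotient_span W S \<Longrightarrow>
           coset_add (coset_scale W c A) B \<in> quotient_span W S"

definition quotient_finite_dim :: "'u::complex_vector set \<Rightarrow> 'u set set \<Rightarrow> bool"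
  where "quotient_finite_dim W D \<longleftrightarrow> (\<exists>B. finite B \<and> B \<subseteq> D \<and> D = quotient_span W B)"

definition R_space :: "'u::complex_vector set \<Rightarrow> ('u \<Rightarrow> int \<Rightarrow> 'u \<Rightarrow> 'u) \<Rightarrow> 'u set set"
  where "R_space U Y = coset (C2 U Y) ` U"

abbreviation C2_sym :: "('v::complex_vector \<Rightarrow> int \<Rightarrow> 'v \<Rightarrow> 'v) \<Rightarrow> ('v, 'v) tensor set"
  where "C2_sym Y \<equiv> C2 S2_fixed (tensor_square_prod Y)"

definition eta_bar ::
  "('v::complex_vector \<Rightarrow> int \<Rightarrow> 'v \<Rightarrow> 'v) \<Rightarrow> 'v \<Rightarrow> 'v \<Rightarrow> ('v, 'v) tensor set"
  where "eta_bar Y vac a = coset (C2_sym Y) (eta vac a)"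

definition D_space ::
  "('v::complex_vector \<Rightarrow> int \<Rightarrow> 'v \<Rightarrow> 'v) \<Rightarrow> 'v \<Rightarrow> 'v \<Rightarrow> 'v \<Rightarrow> ('v, 'v) tensor set set"
  where "D_space Y vac x y =
    quotient_span (C2_sym Y) {eta_bar Y vac (Y x (- n) y) | n. n > 0}"

subsection \<open>Consistency facts\<close>

lemma csubspace_C2: "csubspace (C2 U Y)"
  by (simp add: C2_def)

lemma coset_add_coset:
  assumes "csubspace W"
  shows "coset_add (coset W u) (coset W v) = coset W (u + v)"
proof (intro set_eqI iffI)
  fix z assume "z \<in> coset_add (coset W u) (coset W v)"
  then obtain w w' where "w \<in> W" "w' \<in> W" "z = (u + v) + (w + w')"
    by (auto simp: coset_add_def coset_def algebra_simps)
  then show "z \<in> coset W (u + v)"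
    using cvec.subspace_add[OF assms] unfolding coset_def by blast
next
  fix z assume "z \<in> coset W (u + v)"
  then obtain w where w: "w \<in> W" "z = (u + w) + (v + 0)"
    by (auto simp: coset_def algebra_simps)
  then show "z \<in> coset_add (coset W u) (coset W v)"
    using cvec.subspace_0[OF assms] unfolding coset_add_def coset_def by blast
qed

lemma coset_scale_coset:
  assumes "csubspace W"
  shows "coset_scale W c (coset W u) = coset W (c *\<^sub>C u)"
proof (intro set_eqI iffI)
  fix z assume "z \<in> coset_scale W c (coset W u)"
  then obtain w w' where "w \<in> W" "w' \<in> W" "z = c *\<^sub>C u + (c *\<^sub>C w + w')"
    by (auto simp: coset_scale_def coset_def cvec.scale_right_distrib add.assoc)
  then show "z \<in> coset W (c *\<^sub>C u)"
    using cvec.subspace_add[OF assms] cvec.subspace_scale[OF assms] unfolding coset_def by blast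
next
  fix z assume "z \<in> coset W (c *\<^sub>C u)"
  then obtain w where w: "w \<in> W" "z = c *\<^sub>C (u + 0) + w"
    by (auto simp: coset_def)
  then show "z \<in> coset_scale W c (coset W u)"
    using cvec.subspace_0[OF assms] unfolding coset_scale_def coset_def by blast
qed

lemma quotient_span_cosets:
  assumes W: "csubspace W"
  shows "quotient_span W (coset W ` S) = coset W ` cspan S"
proof (intro equalityI subsetI)
  fix A assume "A \<in> quotient_span W (coset W ` S)"
  then show "A \<in> coset W ` cspan S"
  proof induction
    case zero
    show ?case by (intro imageI cvec.span_zero)
  next
    case (step A B c)
    then obtain s b where "s \<in> S" "A = coset W s" "b \<in> cspan S" "B = coset W b" by auto
    then show ?case
      by (auto simp: coset_scale_coset coset_add_coset W
          intro!: imageI cvec.span_add cvec.span_scale intro: cvec.span_base)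
  qed
next
  fix A assume "A \<in> coset W ` cspan S"
  then obtain u where u: "A = coset W u" "u \<in> cspan S" by auto
  from u(2) have "coset W u \<in> quotient_span W (coset W ` S)"
  proof (induction rule: cvec.span_induct_alt)
    case base
    show ?case by (rule quotient_span.zero)
  next
    case (step c x y)
    then show ?case
      using quotient_span.step[of "coset W x" "coset W ` S" "coset W y" W c]
      by (simp add: coset_scale_coset coset_add_coset W)
  qed
  with u(1) show "A \<in> quotient_span W (coset W ` S)" by simp
qed

lemma tensor_zero_left [simp]: "(0 :: 'a::complex_vector) \<otimes> (b :: 'b::complex_vector) = 0"
  by (metis cbilinear_scale_left cbilinear_pure_tensor cvec.scale_zero_left)

lemma tensor_zero_right [simp]: "(a :: 'a::complex_vector) \<otimes> (0 :: 'b::complex_vector) = 0"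
  by (metis cbilinear_scale_right cbilinear_pure_tensor cvec.scale_zero_left)

lemma cbilinear_flip: "cbilinear (\<lambda>a b. b \<otimes> a)"
  using cbilinear_pure_tensor by (auto simp: cbilinear_def)

lemma tensor_swap_pure: "tensor_swap (a \<otimes> b) = b \<otimes> a"
  by (simp add: tensor_swap_def tensor_lift_pure cbilinear_flip)

lemma clinear_tensor_swap: "clinear tensor_swap"
  unfolding tensor_swap_def by (rule clinear_tensor_lift[OF cbilinear_flip])

lemma eta_fixed: "eta vac a \<in> S2_fixed"
  by (simp add: S2_fixed_def eta_def clinear_add[OF clinear_tensor_swap] tensor_swap_pure
      add.commute)

context vertex_operator_algebra
begin

lemma finite_support: "finite {i::int. Y a i c \<otimes> Y b (n - 1 - i) d \<noteq> 0}"
proof -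
  obtain M N where "\<forall>i\<ge>M. Y a i c = 0" "\<forall>i\<ge>N. Y b i d = 0"
    using truncation by metis
  then have "{i. Y a i c \<otimes> Y b (n - 1 - i) d \<noteq> 0} \<subseteq> {n - 1 - N..M}"
    by (smt (verit) mem_Collect_eq subsetI tensor_zero_left tensor_zero_right atLeastAtMost_iff)
  then show ?thesis by (rule finite_subset) simp
qed

lemma Sum_any_scaleC:
  assumes "finite {i. f i \<noteq> (0::'x::complex_vector)}"
  shows "Sum_any (\<lambda>i. k *\<^sub>C f i) = k *\<^sub>C Sum_any f"
proof -
  have "Sum_any (\<lambda>i. k *\<^sub>C f i) = (\<Sum>i\<in>{i. f i \<noteq> 0}. k *\<^sub>C f i)"
    by (rule Sum_any.expand_superset) (use assms in auto)
  then show ?thesis by (simp add: Sum_any.expand_set cvec.scale_sum_right)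
qed

lemmas Y_lin = cbilinear_add_left[OF bilinear] cbilinear_add_right[OF bilinear]
  cbilinear_scale_left[OF bilinear] cbilinear_scale_right[OF bilinear]
lemmas T_lin = cbilinear_add_left[OF cbilinear_pure_tensor]
  cbilinear_add_right[OF cbilinear_pure_tensor]
  cbilinear_scale_left[OF cbilinear_pure_tensor] cbilinear_scale_right[OF cbilinear_pure_tensor]

lemma cbilinear_prod_pure_inner: "cbilinear (tensor_square_prod_pure Y n a b)"
  unfolding tensor_square_prod_pure_def
  by (rule cbilinearI)
     (simp_all add: Y_lin T_lin Sum_any.distrib Sum_any_scaleC finite_support)

lemma cbilinear_prod_pure_outer: "cbilinear (\<lambda>a b. tensor_lift (tensor_square_prod_pure Y n a b) w)"
proof -
  have lin: "clinear (tensor_lift (tensor_square_prod_pure Y n a b))" for a b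
    by (rule clinear_tensor_lift[OF cbilinear_prod_pure_inner])
  note ls = clinear_add[OF lin] clinear_scale[OF lin]
  have ladd: "clinear (\<lambda>w. f w + g w)" if "clinear f" "clinear g"
    for f g :: "('v, 'v) tensor \<Rightarrow> ('v, 'v) tensor"
    by (rule clinearI) (simp_all add: that[THEN clinear_add] that[THEN clinear_scale]
        cvec.scale_right_distrib)
  have lsc: "clinear (\<lambda>w. c *\<^sub>C f w)" if "clinear f" 
    for c and f :: "('v, 'v) tensor \<Rightarrow> ('v, 'v) tensor"
    by (rule clinearI) (simp_all add: that[THEN clinear_add] that[THEN clinear_scale]
        cvec.scale_right_distrib mult.commute)
  note ext = clinear_eq_on_span[OF _ _ _ cspan_pure_tensors]
  note pure = tensor_lift_pure[OF cbilinear_prod_pure_inner]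
  show ?thesis
  proof (rule cbilinearI)
    fix a a' b b' :: 'v and c
    show "tensor_lift (tensor_square_prod_pure Y n (a + a') b) w
        = tensor_lift (tensor_square_prod_pure Y n a b) w
          + tensor_lift (tensor_square_prod_pure Y n a' b) w"
      by (rule ext[OF lin ladd[OF lin lin]])
         (auto simp: pure tensor_square_prod_pure_def Y_lin T_lin Sum_any.distrib finite_support)
    show "tensor_lift (tensor_square_prod_pure Y n a (b + b')) w
        = tensor_lift (tensor_square_prod_pure Y n a b) w
          + tensor_lift (tensor_square_prod_pure Y n a b') w"
      by (rule ext[OF lin ladd[OF lin lin]])
         (auto simp: pure tensor_square_prod_pure_def Y_lin T_lin Sum_any.distrib finite_support)
    show "tensor_lift (tensor_square_prod_pure Y n (c *\<^sub>C a) b) w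
        = c *\<^sub>C tensor_lift (tensor_square_prod_pure Y n a b) w"
      by (rule ext[OF lin lsc[OF lin]])
         (auto simp: pure tensor_square_prod_pure_def Y_lin T_lin Sum_any_scaleC finite_support)
    show "tensor_lift (tensor_square_prod_pure Y n a (c *\<^sub>C b)) w
        = c *\<^sub>C tensor_lift (tensor_square_prod_pure Y n a b) w"
      by (rule ext[OF lin lsc[OF lin]])
         (auto simp: pure tensor_square_prod_pure_def Y_lin T_lin Sum_any_scaleC finite_support)
  qed
qed

lemma tensor_square_prod_pure_eq:
  "tensor_square_prod Y (a \<otimes> b) n (c \<otimes> d) = Sum_any (\<lambda>i::int. Y a i c \<otimes> Y b (n - 1 - i) d)"
  unfolding tensor_square_prod_def
  by (subst tensor_lift_pure[OF cbilinear_prod_pure_outer],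
      subst tensor_lift_pure[OF cbilinear_prod_pure_inner], rule tensor_square_prod_pure_def)

lemma clinear_tensor_square_prod_left: "clinear (\<lambda>u. tensor_square_prod Y u n w)"
  unfolding tensor_square_prod_def by (rule clinear_tensor_lift[OF cbilinear_prod_pure_outer])

lemma clinear_tensor_square_prod_right: "clinear (tensor_square_prod Y u n)"
proof -
  have lin: "clinear (tensor_lift (tensor_square_prod_pure Y n a b))" for a b
    by (rule clinear_tensor_lift[OF cbilinear_prod_pure_inner])
  show ?thesis
    by (rule clinearI)
       (simp_all add: tensor_square_prod_def clinear_add[OF lin] clinear_scale[OF lin]
         tensor_lift_add_fun tensor_lift_scale_fun)
qed

lemma tensor_swap_prod:
  "tensor_swap (tensor_square_prod Y u n w) = tensor_square_prod Y (tensor_swap u) n (tensor_swap w)"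
proof -
  have comp: "clinear (\<lambda>u. g (f u))" if "clinear f" "clinear g"
    for f g :: "('v, 'v) tensor \<Rightarrow> ('v, 'v) tensor"
    by (rule clinearI) (simp_all add: that[THEN clinear_add] that[THEN clinear_scale])
  note ext = clinear_eq_on_span[OF _ _ _ cspan_pure_tensors]
  note L = clinear_tensor_square_prod_left
  note R = clinear_tensor_square_prod_right
  note S = clinear_tensor_swap
  have pure: "tensor_swap (tensor_square_prod Y (a \<otimes> b) n (c \<otimes> d))
      = tensor_square_prod Y (b \<otimes> a) n (d \<otimes> c)" for a b c d
  proof -
    let ?A = "{i. Y a i c \<otimes> Y b (n - 1 - i) d \<noteq> 0}"
    have sw0: "tensor_swap 0 = 0" by (rule clinear_0[OF S])
    have "tensor_swap (sum f A) = (\<Sum>i\<in>A. tensor_swap (f i))"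
      for f :: "int \<Rightarrow> ('v, 'v) tensor" and A
      by (induction A rule: infinite_finite_induct) (simp_all add: sw0 clinear_add[OF S])
    then have "tensor_swap (Sum_any (\<lambda>i. Y a i c \<otimes> Y b (n - 1 - i) d))
        = (\<Sum>i\<in>?A. Y b (n - 1 - i) d \<otimes> Y a i c)"
      by (simp add: Sum_any.expand_set tensor_swap_pure)
    also have "\<dots> = Sum_any (\<lambda>i. Y b (n - 1 - i) d \<otimes> Y a i c)"
    proof (rule Sum_any.expand_superset[symmetric, OF finite_support], rule subsetI, rule CollectI)
      fix i assume "i \<in> {i. Y b (n - 1 - i) d \<otimes> Y a i c \<noteq> 0}"
      then show "Y a i c \<otimes> Y b (n - 1 - i) d \<noteq> 0"
        by (metis (mono_tags, lifting) mem_Collect_eq tensor_swap_pure sw0)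
    qed
    also have "\<dots> = Sum_any (\<lambda>i. Y b i d \<otimes> Y a (n - 1 - i) c)"
      by (rule Sum_any.reindex_cong[of "\<lambda>i. n - 1 - i"])
         (auto simp: o_def intro!: o_bij[of "\<lambda>i. n - 1 - i"])
    finally show ?thesis by (simp add: tensor_square_prod_pure_eq)
  qed
  have left: "tensor_swap (tensor_square_prod Y (a \<otimes> b) n w)
      = tensor_square_prod Y (b \<otimes> a) n (tensor_swap w)" for a b
    by (rule ext[OF comp[OF R S] comp[OF S R]]) (auto simp: pure tensor_swap_pure)
  show ?thesis
    by (rule clinear_eq_on_span[OF comp[OF L S] comp[OF S L] _ cspan_pure_tensors])
       (auto simp: left tensor_swap_pure)
qed

lemma S2_fixed_closed:
  "u \<in> S2_fixed \<Longrightarrow> w \<in> S2_fixed \<Longrightarrow> tensor_square_prod Y u n w \<in> S2_fixed"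
  by (simp add: S2_fixed_def tensor_swap_prod)

lemma D_space_subset_R_space: "D_space Y vac x y \<subseteq> R_space S2_fixed (tensor_square_prod Y)"
proof -
  let ?S = "eta vac ` {Y x (- n) y | n. n > 0}"
  have gens: "{eta_bar Y vac (Y x (- n) y) | n. n > 0} = coset (C2_sym Y) ` ?S"
    by (auto simp: eta_bar_def)
  have "csubspace (S2_fixed :: ('v, 'v) tensor set)"
    by (auto simp: cvec.subspace_def S2_fixed_def clinear_add[OF clinear_tensor_swap]
        clinear_scale[OF clinear_tensor_swap] clinear_0[OF clinear_tensor_swap])
  then have "cspan ?S \<subseteq> S2_fixed"
    by (intro cvec.span_minimal) (auto simp: eta_fixed)
  then show ?thesis
    by (auto simp: D_space_def R_space_def gens quotient_span_cosets csubspace_C2)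
qed

end

end

(* A linear functional on R(T^2(V)^{S_2}) gives a form phi(u, v) on V for which all modes x_(k), k <= -2,
   are skew. It suffices that phi(b_(-m) u, v) vanishes for m large, with a bound independent of phi.
   Since the modes of all products a_(n) b are skew as well, the Borcherds identity yields exchange
   relations between b_(-m) a_(k) and a_(-m') b_(k'). By simplicity there are a, c and e >= 0 with
   a_(e) c = vac and a_(i) c = 0 for i > e. Applying the exchange relations for b with a and with c in
   both orders and subtracting expresses a sum over commutators [a_(k), c_(l)], weighted by
   (h + k + l)! / (k! l!), through iterated products of a, b, c with coefficients polynomial in the
   mode offsets, whereas the coefficient of the contraction a_(e) c grows like 2^N (h + N)! / N!.
   Finite differences in the offsets separate the two and leave a nonzero multiple of phi(b_(-m) u, v). *)

theory Submission
  imports Defs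
begin

section \<open>Finite differences\<close>

text \<open>Skewness is available for modes <= -2 only. The identity map, being vac_(-1), lies just
  outside this range and is not skew, so a contraction to the vacuum contributes 2 phi instead of 0,
  whereas a product met at a mode <= -2 can be turned into a commutator. The difference in growth
  comes from a sign. Exchanging b with a by the Borcherds identity with middle index -(h + l) - 1
  costs (-1)^(h + l + 1). With b outermost, a diagonal k + l = N is summed against plain binomial
  coefficients, whose sum is 2^N; with a or c outermost the signs alternate along the diagonal, and
  the sum becomes an N-th difference of a polynomial, which is zero for large N. The bound must not
  depend on phi because membership in C_2 is tested by a separating functional, which may change
  with m.\<close>

definition fdiff :: "(nat \<Rightarrow> 'a::ab_group_add) \<Rightarrow> nat \<Rightarrow> 'a"
  where "fdiff f = (\<lambda>n. f (Suc n) - f n)"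

lemma fdiff_pow_Suc: "(fdiff ^^ Suc m) f n = (fdiff ^^ m) f (Suc n) - (fdiff ^^ m) f n"
  by (simp add: fdiff_def)

lemma fdiff_pow_Suc_right: "(fdiff ^^ Suc m) f = (fdiff ^^ m) (fdiff f)"
  by (simp add: funpow_swap1)

text \<open>Only the values at n, ..., n + m enter, so an identity known on a finite range of a
  parameter can still be differenced.\<close>

lemma fdiff_pow_cong:
  assumes "\<And>i. i \<le> m \<Longrightarrow> f (n + i) = g (n + i)"
  shows "(fdiff ^^ m) f n = (fdiff ^^ m) g n"
  using assms
proof (induction m arbitrary: n)
  case 0
  from 0[of 0] show ?case by simp
next
  case (Suc m)
  have "(fdiff ^^ m) f n = (fdiff ^^ m) g n" by (rule Suc.IH) (use Suc.prems in auto)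
  moreover have "(fdiff ^^ m) f (Suc n) = (fdiff ^^ m) g (Suc n)"
    by (rule Suc.IH) (use Suc.prems[of "Suc _"] in auto)
  ultimately show ?case by (simp only: fdiff_pow_Suc)
qed

lemma fdiff_pow_sum:
  "(fdiff ^^ m) (\<lambda>n. \<Sum>k\<in>A. f k n) n = (\<Sum>k\<in>A. (fdiff ^^ m) (f k) n)"
  by (induction m arbitrary: n) (simp_all add: fdiff_pow_Suc sum_subtractf del: funpow.simps(2))

lemma fdiff_pow_mult:
  "(fdiff ^^ m) (\<lambda>n. c * f n) n = (c :: 'a::ring) * (fdiff ^^ m) f n"
  by (induction m arbitrary: n) (simp_all add: fdiff_pow_Suc algebra_simps del: funpow.simps(2))

lemma fdiff_pow_diff:
  "(fdiff ^^ m) (\<lambda>n. f n - g n) n = (fdiff ^^ m) f n - (fdiff ^^ m) g n"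
  by (induction m arbitrary: n) (simp_all add: fdiff_pow_Suc algebra_simps del: funpow.simps(2))

lemma fdiff_pow_gbinomial:
  fixes x :: "'a::field_char_0"
  shows "(fdiff ^^ m) (\<lambda>n. (x + of_nat n) gchoose i) n
    = (if m \<le> i then (x + of_nat n) gchoose (i - m) else 0)"
proof (induction m arbitrary: n)
  case (Suc m)
  show ?case
  proof (cases "i - m")
    case 0
    then show ?thesis by (auto simp: fdiff_pow_Suc Suc simp del: funpow.simps(2))
  next
    case j: (Suc j)
    then have "i - Suc m = j" "Suc m \<le> i" by auto
    moreover have "(x + of_nat (Suc n)) gchoose Suc j
        = ((x + of_nat n) gchoose j) + ((x + of_nat n) gchoose Suc j)"
      using gbinomial_Suc_Suc[of "x + of_nat n" j] by (simp add: add_ac)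
    ultimately show ?thesis using j
      by (simp add: fdiff_pow_Suc Suc  del: funpow.simps(2) of_nat_Suc)
  qed
qed simp

lemma fdiff_pow_expand:
  fixes f :: "nat \<Rightarrow> 'a::comm_ring_1"
  shows "(fdiff ^^ m) f n = (\<Sum>i\<le>m. (-1) ^ (m - i) * of_nat (m choose i) * f (n + i))"
proof (induction m arbitrary: n)
  case (Suc m)
  have top: "of_nat (m choose Suc m) * y = (0::'a)" for y
    by (subst binomial_eq_0) simp_all
  have a: "(\<Sum>i\<le>m. (-1) ^ (Suc m - i) * of_nat (m choose i) * f (n + i)) = - (fdiff ^^ m) f n"
    by (simp add: Suc sum_negf[symmetric] Suc_diff_le)
  have "(\<Sum>i\<le>Suc m. (-1) ^ (Suc m - i) * of_nat (Suc m choose i) * f (n + i))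
    = (-1) ^ Suc m * f n + (\<Sum>i\<le>m. (-1) ^ (m - i) * of_nat (Suc m choose Suc i) * f (Suc n + i))"
    by (subst sum.atMost_Suc_shift) simp
  also have "\<dots> = (\<Sum>i\<le>m. (-1) ^ (m - i) * of_nat (m choose i) * f (Suc n + i)) +
     ((-1) ^ Suc m * f n + (\<Sum>i\<le>m. (-1) ^ (m - i) * of_nat (m choose Suc i) * f (Suc n + i)))"
    by (simp add: algebra_simps sum.distrib)
  also have "(-1) ^ Suc m * f n + (\<Sum>i\<le>m. (-1) ^ (m - i) * of_nat (m choose Suc i) * f (Suc n + i))
     = (\<Sum>i\<le>Suc m. (-1) ^ (Suc m - i) * of_nat (m choose i) * f (n + i))"
    by (simp only: sum.atMost_Suc_shift[of _ m]) (simp add: top)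
  also have "\<dots> = - (fdiff ^^ m) f n" using a by (simp add: top)
  finally show ?case by (simp only: fdiff_pow_Suc Suc diff_conv_add_uminus)
qed simp

text \<open>Polynomiality is encoded by a vanishing difference, so no polynomial has to be
  exhibited. The strict bound makes m = 0 the zero function, the base case for products.\<close>

definition poly_deg_less :: "nat \<Rightarrow> (nat \<Rightarrow> 'a::comm_ring_1) \<Rightarrow> bool"
  where "poly_deg_less m f \<longleftrightarrow> (fdiff ^^ m) f = (\<lambda>_. 0)"

lemma poly_deg_less_0: "poly_deg_less 0 f \<longleftrightarrow> f = (\<lambda>_. 0)"
  by (simp add: poly_deg_less_def)

lemma poly_deg_less_Suc: "poly_deg_less (Suc m) f \<longleftrightarrow> poly_deg_less m (fdiff f)"
  by (simp only: poly_deg_less_def fdiff_pow_Suc_right)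

lemma poly_deg_less_mono: "poly_deg_less m f \<Longrightarrow> m \<le> n \<Longrightarrow> poly_deg_less n f"
proof (induction n)
  case (Suc n)
  then show ?case
    by (cases "m = Suc n") (auto simp: poly_deg_less_def fdiff_def)
qed simp

lemma poly_deg_less_sum:
  "(\<And>k. k \<in> A \<Longrightarrow> poly_deg_less m (f k)) \<Longrightarrow> poly_deg_less m (\<lambda>n. \<Sum>k\<in>A. f k n)"
  by (auto simp: poly_deg_less_def fun_eq_iff fdiff_pow_sum)

lemma poly_deg_less_diff:
  "poly_deg_less m f \<Longrightarrow> poly_deg_less m g \<Longrightarrow> poly_deg_less m (\<lambda>n. f n - g n)"
  by (auto simp: poly_deg_less_def fun_eq_iff fdiff_pow_diff)

lemma poly_deg_less_cmult: "poly_deg_less m f \<Longrightarrow> poly_deg_less m (\<lambda>n. c * f n)"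
  by (auto simp: poly_deg_less_def fun_eq_iff fdiff_pow_mult)

lemma poly_deg_less_add:
  assumes "poly_deg_less m f" "poly_deg_less m g"
  shows "poly_deg_less m (\<lambda>n. f n + g n)"
  using poly_deg_less_diff[OF assms(1) poly_deg_less_cmult[OF assms(2), of "-1"]] by simp

lemma poly_deg_less_shift: "poly_deg_less m f \<Longrightarrow> poly_deg_less m (\<lambda>n. f (Suc n))"
proof -
  have "(fdiff ^^ m) (\<lambda>n. f (Suc n)) n = (fdiff ^^ m) f (Suc n)" for n
    by (induction m arbitrary: n) (simp_all add: fdiff_pow_Suc del: funpow.simps(2))
  then show "poly_deg_less m f \<Longrightarrow> ?thesis" by (simp add: poly_deg_less_def fun_eq_iff)
qed

text \<open>By the Leibniz rule, the difference of f g is f(n + 1) times that of g plus g times that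
  of f; each summand has a smaller sum of bounds.\<close>

lemma poly_deg_less_mult:
  "poly_deg_less m f \<Longrightarrow> poly_deg_less n g \<Longrightarrow> poly_deg_less (m + n) (\<lambda>x. f x * g x)"
proof (induction "m + n" arbitrary: m n f g)
  case 0
  then show ?case by (simp add: poly_deg_less_0)
next
  case (Suc k)
  show ?case
  proof (cases "m = 0 \<or> n = 0")
    case True
    then have "(\<lambda>x. f x * g x) = (\<lambda>x. 0)"
      using Suc.prems by (auto simp: poly_deg_less_0 fun_eq_iff)
    then show ?thesis
      using poly_deg_less_mono[of 0 "\<lambda>x. f x * g x" "m + n"] by (simp add: poly_deg_less_0)
  next
    case False
    then obtain m' n' where mn: "m = Suc m'" "n = Suc n'" by (metis not0_implies_Suc)
    have "poly_deg_less (m + n') (\<lambda>x. f (Suc x) * fdiff g x)"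
      by (rule Suc.hyps(1)) (use Suc mn poly_deg_less_shift[of m f] in \<open>auto simp: poly_deg_less_Suc[of n']\<close>)
    moreover have "poly_deg_less (m' + n) (\<lambda>x. fdiff f x * g x)"
      by (rule Suc.hyps(1)) (use Suc mn in \<open>auto simp: poly_deg_less_Suc\<close>)
    moreover have "fdiff (\<lambda>x. f x * g x) = (\<lambda>x. f (Suc x) * fdiff g x + fdiff f x * g x)"
      by (auto simp: fdiff_def algebra_simps)
    moreover have "m + n' = k" "m' + n = k" "m + n = Suc k" using mn Suc.hyps by auto
    ultimately show ?thesis by (simp add: poly_deg_less_Suc poly_deg_less_add)
  qed
qed

lemma poly_deg_less_gbinomial:
  "poly_deg_less (Suc i) (\<lambda>n. (x + of_nat n :: 'a::field_char_0) gchoose i)"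
  by (simp add: poly_deg_less_def fun_eq_iff fdiff_pow_gbinomial del: funpow.simps(2))

text \<open>Pascal's rule gives - C(x - 1 - n, i) as the difference of C(x - n, i + 1). This form is
  met because one mode offset falls as another one rises.\<close>

lemma poly_deg_less_gbinomial_reflected:
  "poly_deg_less (Suc i) (\<lambda>n. (x - of_nat n :: 'a::field_char_0) gchoose i)"
proof (induction i arbitrary: x)
  case 0
  show ?case by (simp add: poly_deg_less_def fdiff_def)
next
  case (Suc i)
  have "fdiff (\<lambda>n. (x - of_nat n) gchoose Suc i) = (\<lambda>n. - 1 * ((x - 1 - of_nat n) gchoose i))"
  proof
    fix n
    show "fdiff (\<lambda>n. (x - of_nat n) gchoose Suc i) n = - 1 * ((x - 1 - of_nat n) gchoose i)"
      using gbinomial_Suc_Suc[of "x - 1 - of_nat n" i]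
      by (simp add: fdiff_def algebra_simps)
  qed
  with poly_deg_less_cmult[OF Suc, of "- 1" "x - 1"] show ?case
    by (simp only: poly_deg_less_Suc[of "Suc i"])
qed

text \<open>The difference of 2^n C(n + c, k) is the function itself plus 2 * 2^n C(n + c, k - 1) >=
  0, so repeated differencing never makes it smaller.\<close>

lemma fdiff_pow_two_power_binomial:
  "(fdiff ^^ m) (\<lambda>n. 2 ^ n * real ((n + c) choose k)) n \<ge> 2 ^ n * real ((n + c) choose k)"
proof (induction m arbitrary: k)
  case (Suc m)
  let ?F = "\<lambda>k n. 2 ^ n * real ((n + c) choose k)"
  show ?case
  proof (cases k)
    case 0
    have "fdiff (?F 0) = ?F 0" by (auto simp: fdiff_def)
    then show ?thesis using Suc[of 0] 0 by (simp only: fdiff_pow_Suc_right)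
  next
    case k: (Suc l)
    have "fdiff (?F k) = (\<lambda>n. ?F k n - (- 2) * ?F l n)"
      by (auto simp: fdiff_def k algebra_simps)
    then have "(fdiff ^^ Suc m) (?F k) n = (fdiff ^^ m) (?F k) n - (- 2) * (fdiff ^^ m) (?F l) n"
      by (simp only: fdiff_pow_Suc_right fdiff_pow_diff fdiff_pow_mult)
    moreover have "(fdiff ^^ m) (?F l) n \<ge> 0"
      using Suc[of l] by (rule order_trans[rotated]) simp
    ultimately show ?thesis using Suc[of k] by simp
  qed
qed simp

lemma poly_deg_less_fdiff_pow:
  "(\<And>s. poly_deg_less m (V s)) \<Longrightarrow> poly_deg_less m (\<lambda>t. (fdiff ^^ e) (\<lambda>s. V s t) n)"
proof (induction e arbitrary: n)
  case (Suc e)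
  show ?case
    unfolding fdiff_pow_Suc by (intro poly_deg_less_diff Suc)
qed simp

lemma poly_deg_less_gbinomial_prod:
  fixes c x y :: "'a::field_char_0"
  assumes "i < I" "j < J"
  shows "poly_deg_less (I + J) (\<lambda>t. c * (((x + of_nat t) gchoose (i - N)) * (y gchoose j)))"
    and "poly_deg_less (I + J) (\<lambda>t. c * (((x + of_nat t) gchoose (i - N)) * ((y - of_nat t) gchoose j)))"
proof -
  have x: "poly_deg_less I (\<lambda>t. (x + of_nat t) gchoose (i - N))"
    by (rule poly_deg_less_mono[OF poly_deg_less_gbinomial]) (use assms in simp)
  have y: "poly_deg_less J (\<lambda>t. (y - of_nat t) gchoose j)"
    by (rule poly_deg_less_mono[OF poly_deg_less_gbinomial_reflected]) (use assms in simp)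
  have y': "poly_deg_less J (\<lambda>t. y gchoose j)"
  proof -
    have "poly_deg_less 1 (\<lambda>t. y gchoose j)" by (simp add: poly_deg_less_def fdiff_def)
    then show ?thesis by (rule poly_deg_less_mono) (use assms in simp)
  qed
  show "poly_deg_less (I + J) (\<lambda>t. c * (((x + of_nat t) gchoose (i - N)) * (y gchoose j)))"
    by (intro poly_deg_less_cmult poly_deg_less_mult x y')
  show "poly_deg_less (I + J) (\<lambda>t. c * (((x + of_nat t) gchoose (i - N)) * ((y - of_nat t) gchoose j)))"
    by (intro poly_deg_less_cmult poly_deg_less_mult x y)
qed

lemma fdiff_pow_of_real:
  "(fdiff ^^ m) (\<lambda>n. complex_of_real (f n)) n = complex_of_real ((fdiff ^^ m) f n)"
  by (induction m arbitrary: n) (simp_all add: fdiff_pow_Suc del: funpow.simps(2))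

lemma sum_square_eq_sum_diagonals:
  fixes G :: "nat \<Rightarrow> nat \<Rightarrow> 'a::comm_monoid_add"
  assumes "\<And>k l. k \<ge> L \<or> l \<ge> L \<Longrightarrow> G k l = 0"
  shows "(\<Sum>l<L. \<Sum>k<L. G k l) = (\<Sum>N<2*L. \<Sum>k\<le>N. G k (N - k))"
proof -
  have G: "k < L \<and> l < L" if "G k l \<noteq> 0" for k l
    using assms that not_le by blast
  have "(\<Sum>l<L. \<Sum>k<L. G k l) = (\<Sum>k<L. \<Sum>l<L. G k l)" by (rule sum.swap)
  also have "\<dots> = (\<Sum>(k, l)\<in>{..<L} \<times> {..<L}. G k l)" by (simp add: sum.cartesian_product)
  also have "\<dots> = (\<Sum>(k, l)\<in>{(k, l). k + l < 2 * L}. G k l)"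
  proof (rule sum.mono_neutral_left)
    have "{(k, l). k + l < 2 * L} \<subseteq> {..<2*L} \<times> {..<2*L}" by auto
    then show "finite {(k, l). k + l < 2 * L}" by (rule finite_subset) simp
  qed (use G in auto)
  also have "\<dots> = (\<Sum>N<2*L. \<Sum>k\<le>N. G k (N - k))" by (rule sum.triangle_reindex)
  finally show ?thesis .
qed

section \<open>The factorial weights of the double sums\<close>

definition fact_ratio :: "nat \<Rightarrow> nat \<Rightarrow> complex"
  where "fact_ratio h N = fact (h + N) / fact N"

text \<open>For fixed l this is (h + l)! / l! times the coefficients C(h + l + k, k) of the
  Borcherds identity with middle index -(h + l) - 1. The factor is chosen to make the weight
  symmetric in k and l, so that the two orders of a and c can be compared term by term.\<close>

definition fact_coeff :: "nat \<Rightarrow> nat \<Rightarrow> nat \<Rightarrow> complex"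
  where "fact_coeff h k l = fact (h + k + l) / (fact k * fact l)"

lemma fact_coeff_commute: "fact_coeff h k l = fact_coeff h l k"
  by (simp add: fact_coeff_def add_ac mult.commute)

lemma fact_coeff_diagonal: "k \<le> N \<Longrightarrow> fact_coeff h k (N - k) = fact_ratio h N * of_nat (N choose k)"
  by (simp add: fact_coeff_def fact_ratio_def binomial_fact)

lemma fact_coeff_row: "fact_coeff h k l = fact (h + l) / fact l * of_nat ((h + l + k) choose k)"
  by (simp add: fact_coeff_def binomial_fact add_ac)

lemma fact_ratio_eq: "fact_ratio h N = fact h * of_nat ((N + h) choose h)"
  by (simp add: fact_ratio_def binomial_fact add_ac)

lemma fdiff_pow_fact_ratio_nonzero:
  "(fdiff ^^ m) (\<lambda>t. fact_ratio h (k + t) * 2 ^ (k + t)) 0 \<noteq> 0"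
proof -
  define f where "f n = 2 ^ n * real ((n + (k + h)) choose h)" for n
  have "(\<lambda>t. fact_ratio h (k + t) * 2 ^ (k + t))
      = (\<lambda>t. (fact h * 2 ^ k) * complex_of_real (f t))"
    by (simp add: fact_ratio_eq f_def fun_eq_iff power_add add_ac mult_ac)
  moreover have "(fdiff ^^ m) f 0 > 0"
  proof -
    have "0 < 2 ^ 0 * real ((0 + (k + h)) choose h)" by (simp add: zero_less_binomial)
    also have "\<dots> \<le> (fdiff ^^ m) f 0"
      unfolding f_def by (rule fdiff_pow_two_power_binomial)
    finally show ?thesis .
  qed
  ultimately show ?thesis by (simp add: fdiff_pow_mult fdiff_pow_of_real)
qed

section \<open>Vertex algebra identities and contractions\<close>

lemma Sum_any_eq_lessThan:
  fixes f :: "nat \<Rightarrow> 'a::comm_monoid_add"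
  assumes "\<And>i. i \<ge> L \<Longrightarrow> f i = 0"
  shows "Sum_any f = (\<Sum>i<L. f i)"
  by (rule Sum_any.expand_superset) (use assms in \<open>auto simp: not_less[symmetric]\<close>)

context vertex_operator_algebra
begin

lemma Y_zero_left [simp]: "Y 0 n b = 0" and Y_zero_right [simp]: "Y a n 0 = 0"
  using Y_lin(3)[of 0 0 n b] Y_lin(4)[of a n 0 0] by simp_all

lemma commutator:
  assumes "\<And>i::nat. i \<ge> I \<Longrightarrow> Y a (int i) b = 0"
  shows "Y a m (Y b n c) - Y b n (Y a m c)
    = (\<Sum>i<I. (of_int m gchoose i) *\<^sub>C Y (Y a (int i) b) (m + n - int i) c)"
proof -
  have "Sum_any (\<lambda>i::nat. ((- 1) ^ i * (of_int 0 gchoose i)) *\<^sub>C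
           (Y a (m + 0 - int i) (Y b (n + int i) c)
            - ((- 1) powi 0) *\<^sub>C Y b (n + 0 - int i) (Y a (m + int i) c)))
      = Y a m (Y b n c) - Y b n (Y a m c)"
    by (subst Sum_any_eq_lessThan[of 1]) (simp_all add: cvec.scale_one gbinomial_0_left)
  moreover have "Sum_any (\<lambda>i::nat. (of_int m gchoose i) *\<^sub>C Y (Y a (0 + int i) b) (m + n - int i) c)
    = (\<Sum>i<I. (of_int m gchoose i) *\<^sub>C Y (Y a (int i) b) (m + n - int i) c)"
    by (subst Sum_any_eq_lessThan[of I]) (simp_all add: assms)
  ultimately show ?thesis using borcherds[of m a 0 b n c] by simp
qed

lemma truncation_nat: "\<exists>I. \<forall>i\<ge>I. Y a (k + int i) b = 0"
proof -
  obtain N where N: "\<forall>n\<ge>N. Y a n b = 0" using truncation by blast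
  have "\<forall>i\<ge>nat (N - k). Y a (k + int i) b = 0" using N by auto
  then show ?thesis by blast
qed

lemma truncation_finite:
  assumes "finite W"
  shows "\<exists>I. \<forall>w\<in>W. \<forall>i\<ge>I. Y a (k + int i) w = 0"
  using assms
proof induction
  case (insert w W)
  then obtain I where "\<forall>w\<in>W. \<forall>i\<ge>I. Y a (k + int i) w = 0" by blast
  moreover obtain J where "\<forall>i\<ge>J. Y a (k + int i) w = 0" using truncation_nat by blast
  ultimately show ?case by (intro exI[of _ "max I J"]) auto
qed simp

lemma gbinomial_minus_Suc:
  "(-1) ^ i * (of_int (- int g - 1) gchoose i) = (of_nat ((g + i) choose i) :: complex)"
proof -
  have "(of_int (- int g - 1) gchoose i) = (-1) ^ i * ((of_nat (g + i) :: complex) gchoose i)"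
  proof -
    have "of_int (- int g - 1) = - (of_nat g + 1 :: complex)" by simp
    then show ?thesis
      using gbinomial_minus[of "of_nat g + 1 :: complex" i] by (simp only:) simp
  qed
  then show ?thesis by (simp add: binomial_gbinomial power_mult_distrib[symmetric] flip: mult.assoc)
qed

text \<open>With the negative middle index -g - 1, upper negation absorbs the signs (-1)^i and all
  coefficients become natural numbers.\<close>

lemma borcherds_finite:
  assumes "\<And>i. i \<ge> L \<Longrightarrow> Y a (p + int i) c = 0" "\<And>i. i \<ge> L \<Longrightarrow> Y b (q + int i) c = 0"
    and "\<And>i. i \<ge> I \<Longrightarrow> Y a (int i - int g - 1) b = 0"
  shows "(\<Sum>i<I. (of_int p gchoose i) *\<^sub>C Y (Y a (int i - int g - 1) b) (p + q - int i) c)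
    = (\<Sum>i<L. of_nat ((g + i) choose i) *\<^sub>C
         (Y a (p - int g - 1 - int i) (Y b (q + int i) c)
          - ((- 1) ^ Suc g) *\<^sub>C Y b (q - int g - 1 - int i) (Y a (p + int i) c)))"
proof -
  have sgn: "(- 1) powi (- int g - 1) = ((- 1) ^ Suc g :: complex)"
    by (simp add: power_int_def nat_add_distrib)
  have "Sum_any (\<lambda>i::nat. (of_int p gchoose i) *\<^sub>C Y (Y a ((- int g - 1) + int i) b) (p + q - int i) c)
     = (\<Sum>i<I. (of_int p gchoose i) *\<^sub>C Y (Y a (int i - int g - 1) b) (p + q - int i) c)"
    by (subst Sum_any_eq_lessThan[of I]) (use assms(3) in \<open>simp_all add: algebra_simps\<close>)
  moreover have "Sum_any (\<lambda>i::nat. ((- 1) ^ i * (of_int (- int g - 1) gchoose i)) *\<^sub>C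
           (Y a (p + (- int g - 1) - int i) (Y b (q + int i) c)
            - ((- 1) powi (- int g - 1)) *\<^sub>C Y b (q + (- int g - 1) - int i) (Y a (p + int i) c)))
     = (\<Sum>i<L. of_nat ((g + i) choose i) *\<^sub>C
         (Y a (p - int g - 1 - int i) (Y b (q + int i) c)
          - ((- 1) ^ Suc g) *\<^sub>C Y b (q - int g - 1 - int i) (Y a (p + int i) c)))"
    unfolding gbinomial_minus_Suc sgn
    by (subst Sum_any_eq_lessThan[of L]) (use assms(1,2) in \<open>simp_all add: algebra_simps\<close>)
  ultimately show ?thesis using borcherds[of p a "- int g - 1" b q c] by simp
qed

lemma Y_sum_right: "Y a n (sum f A) = (\<Sum>i\<in>A. Y a n (f i))"
  by (induction A rule: infinite_finite_induct) (simp_all add: Y_lin)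

text \<open>The vector in question is L_{-1}^i z / i!, where L_{-1} is
  \<open>Y \<omega> 0\<close>.\<close>

lemma translation_power_vac:
  assumes "\<And>x n. x \<in> S \<Longrightarrow> Y \<omega> n x \<in> S" "csubspace S" "z \<in> S"
  shows "Y z (- 1 - int i) vac \<in> S"
  using assms(3)
proof (induction i arbitrary: z)
  case 0
  then show ?case by (simp add: creation)
next
  case (Suc i)
  have "Y (Y \<omega> 0 z) (- 1 - int i) vac = of_nat (Suc i) *\<^sub>C Y z (- 1 - int (Suc i)) vac"
    using translation[of z "- 1 - int i" vac] by (simp add: algebra_simps)
  then have "Y z (- 1 - int (Suc i)) vac
      = (1 / of_nat (Suc i)) *\<^sub>C Y (Y \<omega> 0 z) (- 1 - int i) vac"
    by (simp add: cvec.scale_one del: of_nat_Suc)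
  also have "\<dots> \<in> S"
    by (intro cvec.subspace_scale[OF assms(2)] Suc.IH assms(1)[OF Suc.prems])
  finally show ?case .
qed

text \<open>By skew-symmetry, the instance \<open>p = -1\<close>, \<open>q = 0\<close>, \<open>c = vac\<close> of the Borcherds identity.\<close>

lemma left_ideal_imp_vertex_ideal:
  assumes S: "csubspace S" and left: "\<And>x n u. u \<in> S \<Longrightarrow> Y x n u \<in> S"
  shows "vertex_ideal Y S"
proof -
  have "Y u n x \<in> S" if u: "u \<in> S" for u n x
  proof -
    obtain I where I: "\<forall>i\<ge>I. Y x (n + int i) u = 0" using truncation_nat by blast
    have "Sum_any (\<lambda>i::nat. ((- 1) ^ i * (of_int n gchoose i)) *\<^sub>C
           (Y x (- 1 + n - int i) (Y u (0 + int i) vac)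
            - ((- 1) powi n) *\<^sub>C Y u (0 + n - int i) (Y x (- 1 + int i) vac)))
        = - (((- 1) powi n) *\<^sub>C Y u n x)"
      by (subst Sum_any_eq_lessThan[of 1]) (simp_all add: creation cvec.scale_one)
    moreover have "Sum_any (\<lambda>i::nat. (of_int (- 1) gchoose i) *\<^sub>C Y (Y x (n + int i) u) (- 1 + 0 - int i) vac)
        = (\<Sum>i<I. (of_int (- 1) gchoose i) *\<^sub>C Y (Y x (n + int i) u) (- 1 - int i) vac)"
      by (subst Sum_any_eq_lessThan[of I]) (use I in simp_all)
    moreover have "(\<Sum>i<I. (of_int (- 1) gchoose i) *\<^sub>C Y (Y x (n + int i) u) (- 1 - int i) vac) \<in> S"
      by (intro cvec.subspace_sum cvec.subspace_scale S translation_power_vac left u)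
    ultimately have "- (((- 1) powi n) *\<^sub>C Y u n x) \<in> S"
      using borcherds[of "- 1" x n u 0 vac] by simp
    then have "(- ((- 1) powi n)) *\<^sub>C (- (((- 1) powi n) *\<^sub>C Y u n x)) \<in> S"
      by (rule cvec.subspace_scale[OF S])
    then show ?thesis
      by (simp add: power_int_mult_distrib[symmetric] cvec.scale_one)
  qed
  with S left show ?thesis by (simp add: vertex_ideal_def)
qed

section \<open>Conformal weights and the existence of a contraction\<close>

lemma csubspace_weight_space: "csubspace (weight_space Y \<omega> d)"
  by (auto simp: cvec.subspace_def weight_space_def Y_lin cvec.scale_right_distrib mult.commute)

text \<open>In the commutator of L_0 with a mode of a, the coefficients C(1, i) leave only i = 0 and
  i = 1: translation evaluates the first term, the eigenvalue of a the second.\<close>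

lemma weight_space_product:
  assumes "a \<in> weight_space Y \<omega> d" "b \<in> weight_space Y \<omega> d'"
  shows "Y a n b \<in> weight_space Y \<omega> (d + d' - n - 1)"
proof -
  obtain I0 where I0: "\<forall>i\<ge>I0. Y \<omega> (0 + int i) a = 0" using truncation_nat by blast
  define I where "I = I0 + 2"
  have I: "\<And>i. i \<ge> I \<Longrightarrow> Y \<omega> (int i) a = 0" using I0 by (auto simp: I_def)
  have z: "(of_int 1 :: complex) gchoose i = 0" if "i \<ge> 2" for i
    using that binomial_gbinomial[of 1 i, where 'a = complex] by (simp add: binomial_eq_0)
  have "Y \<omega> 1 (Y a n b) - Y a n (Y \<omega> 1 b)
    = (\<Sum>i<I. (of_int 1 gchoose i) *\<^sub>C Y (Y \<omega> (int i) a) (1 + n - int i) b)"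
    by (rule commutator) (fact I)
  also have "\<dots> = (\<Sum>i<2. (of_int 1 gchoose i) *\<^sub>C Y (Y \<omega> (int i) a) (1 + n - int i) b)"
    by (rule sum.mono_neutral_right) (use z in \<open>auto simp: I_def\<close>)
  also have "\<dots> = (of_int d - of_int (1 + n)) *\<^sub>C Y a n b"
    using assms(1) by (simp add: numeral_2_eq_2 weight_space_def translation Y_lin cvec.scale_one
        cvec.scale_left_diff_distrib cvec.scale_left_distrib)
  finally have "Y \<omega> 1 (Y a n b) = (of_int d' + (of_int d - of_int (1 + n))) *\<^sub>C Y a n b"
    using assms(2) by (simp add: weight_space_def Y_lin cvec.scale_left_distrib algebra_simps)
  then show ?thesis by (simp add: weight_space_def algebra_simps)
qed

lemma weight_space_independent:
  assumes "finite F" "\<And>d. d \<in> F \<Longrightarrow> f d \<in> weight_space Y \<omega> d" "(\<Sum>d\<in>F. f d) = 0" "d \<in> F"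
  shows "f d = 0"
  using assms
proof (induction F arbitrary: f d)
  case (insert k F)
  have lin: "Y \<omega> 1 (sum g A) = (\<Sum>d\<in>A. Y \<omega> 1 (g d))" for g and A :: "int set"
    by (induction A rule: infinite_finite_induct) (simp_all add: Y_lin)
  have "0 = Y \<omega> 1 (\<Sum>d\<in>insert k F. f d) - of_int k *\<^sub>C (\<Sum>d\<in>insert k F. f d)"
    using insert.prems(2) by simp
  also have "\<dots> = (\<Sum>d\<in>insert k F. of_int (d - k) *\<^sub>C f d)"
    unfolding lin cvec.scale_sum_right sum_subtractf[symmetric]
    by (rule sum.cong[OF refl])
       (use insert.prems(1) in \<open>auto simp: weight_space_def cvec.scale_left_diff_distrib\<close>)
  also have "\<dots> = (\<Sum>d\<in>F. of_int (d - k) *\<^sub>C f d)" using insert.hyps by simp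
  finally have z: "(\<Sum>d\<in>F. of_int (d - k) *\<^sub>C f d) = 0" by simp
  have "of_int (d - k) *\<^sub>C f d = 0" if "d \<in> F" for d
    by (rule insert.IH[of "\<lambda>d. of_int (d - k) *\<^sub>C f d", OF _ z that])
       (use insert.prems(1) csubspace_weight_space in \<open>auto intro!: cvec.subspace_scale\<close>)
  moreover have "k \<notin> F" by (fact insert.hyps)
  ultimately have F: "f d = 0" if "d \<in> F" for d
    using that by (metis cvec.scale_eq_0_iff of_int_eq_0_iff right_minus_eq)
  then have "sum f F = 0" by simp
  with insert.prems(2) insert.hyps have "f k = 0" by simp
  with F insert.prems(3) show ?case by auto
qed simp

lemma weight_decomposition:
  assumes "v \<in> cspan (\<Union>d\<in>D. weight_space Y \<omega> d)"
  shows "\<exists>F f. finite F \<and> F \<subseteq> D \<and> (\<forall>d\<in>F. f d \<in> weight_space Y \<omega> d) \<and> v = (\<Sum>d\<in>F. f d)"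
  using assms
proof (induction rule: cvec.span_induct_alt)
    case base
    show ?case by (rule exI[of _ "{}"]) simp
  next
    case (step c x y)
    then obtain k F f where x: "x \<in> weight_space Y \<omega> k" "k \<in> D"
      and F: "finite F" "\<forall>d\<in>F. f d \<in> weight_space Y \<omega> d" "y = (\<Sum>d\<in>F. f d)"
      "F \<subseteq> D" by blast
    define g where "g d = (if d = k then c *\<^sub>C x else 0) + (if d \<in> F then f d else 0)" for d
    have "\<forall>d\<in>insert k F. g d \<in> weight_space Y \<omega> d"
      using x F csubspace_weight_space
      by (auto simp: g_def intro!: cvec.subspace_add cvec.subspace_scale intro: cvec.subspace_0)
    moreover have "c *\<^sub>C x + y = (\<Sum>d\<in>insert k F. g d)"
    proof -
      have "(\<Sum>d\<in>insert k F. if d \<in> F then f d else 0) = y"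
        unfolding F(3) using F(1) by (intro sum.mono_neutral_cong_right) auto
      moreover have "(\<Sum>d\<in>insert k F. if d = k then c *\<^sub>C x else 0) = c *\<^sub>C x"
        using F(1) by (subst sum.delta) auto
      ultimately show ?thesis by (simp only: g_def sum.distrib)
    qed
    ultimately show ?case using F(1,4) x(2) by (intro exI[of _ "insert k F"] exI[of _ g]) simp
  qed

text \<open>By simplicity the products a_(n) a' with a fixed nonzero a' span everything, hence reach
  the vacuum. The component of weight 0, a line by CFT type, then yields a single homogeneous
  a.\<close>

lemma exists_contraction:
  assumes simple: "simple_vertex_algebra Y" and cft: "CFT_type Y vac \<omega>"
    and nontrivial: "cspan {vac} \<noteq> UNIV"
  shows "\<exists>a a' e. Y a (int e) a' = vac \<and> (\<forall>i>e. Y a (int i) a' = 0)"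
proof -
  have vac0: "vac \<in> weight_space Y \<omega> 0" and neg: "\<And>d. d < 0 \<Longrightarrow> weight_space Y \<omega> d = {0}"
    and w0: "weight_space Y \<omega> 0 = cspan {vac}"
    using cft by (auto simp: CFT_type_def cvec.span_base)
  have "vac \<noteq> 0"
  proof
    assume "vac = 0"
    then have "a = 0" for a :: 'v using creation(2)[of a] by simp
    then have "(UNIV :: 'v set) = {0}" by auto
    with simple show False by (simp add: simple_vertex_algebra_def)
  qed
  obtain d where d: "d > 0" "weight_space Y \<omega> d \<noteq> {0}"
  proof -
    have "\<exists>d>0. weight_space Y \<omega> d \<noteq> {0}"
    proof (rule ccontr)
      assume "\<not> ?thesis"
      then have "weight_space Y \<omega> d \<subseteq> cspan {vac}" for d
        using neg[of d] w0 by (cases d "0::int" rule: linorder_cases) (auto intro: cvec.span_zero)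
      then have "cspan (\<Union>d. weight_space Y \<omega> d) \<subseteq> cspan {vac}"
        by (intro cvec.span_minimal) auto
      with grading nontrivial show False by auto
    qed
    with that show ?thesis by blast
  qed
  then obtain a' where a': "a' \<in> weight_space Y \<omega> d" "a' \<noteq> 0"
    using cvec.subspace_0[OF csubspace_weight_space] by blast
  define S where "S = cspan {Y a n a' | a n. True}"
  have S: "csubspace S" by (simp add: S_def)
  have prod: "Y x m (Y b n a') \<in> S" for x b m n
  proof -
    obtain M where M: "\<forall>n\<ge>M. Y b n a' = 0" using truncation by blast
    obtain p where p: "\<forall>n\<ge>p. Y x n a' = 0" using truncation by blast
    \<comment> \<open>Descending induction on n. As x_(p + i) a' = 0 for i >= 0, the Borcherds
      identity with middle index m - p loses all terms in which x acts first. Its left side lies in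
      S by definition, and its remaining terms with i >= 1 have larger n.\<close>
    have "\<forall>m. Y x m (Y b n a') \<in> S" for n
    proof (induction "nat (M - n)" arbitrary: n rule: less_induct)
      case less
      show ?case
      proof
        fix m
        define K where "K = Suc (nat (M - n))"
        have K: "Y b (n + int i) a' = 0" if "i \<ge> K" for i
          using M that by (auto simp: K_def)
        obtain I where I: "\<forall>i\<ge>I. Y x (m - p + int i) b = 0" using truncation_nat by blast
        have "Sum_any (\<lambda>i::nat. ((- 1) ^ i * (of_int (m - p) gchoose i)) *\<^sub>C
             (Y x (p + (m - p) - int i) (Y b (n + int i) a')
              - ((- 1) powi (m - p)) *\<^sub>C Y b (n + (m - p) - int i) (Y x (p + int i) a')))
          = (\<Sum>i<K. ((- 1) ^ i * (of_int (m - p) gchoose i)) *\<^sub>C Y x (m - int i) (Y b (n + int i) a'))"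
          by (subst Sum_any_eq_lessThan[of K]) (use K p in simp_all)
        also have "\<dots> = Y x m (Y b n a') + (\<Sum>i<nat (M - n). ((- 1) ^ Suc i * (of_int (m - p) gchoose Suc i))
            *\<^sub>C Y x (m - int (Suc i)) (Y b (n + int (Suc i)) a'))"
          unfolding K_def by (subst sum.lessThan_Suc_shift) (simp add: cvec.scale_one)
        finally have "Y x m (Y b n a') =
            Sum_any (\<lambda>i::nat. (of_int p gchoose i) *\<^sub>C Y (Y x (m - p + int i) b) (p + n - int i) a')
            - (\<Sum>i<nat (M - n). ((- 1) ^ Suc i * (of_int (m - p) gchoose Suc i))
            *\<^sub>C Y x (m - int (Suc i)) (Y b (n + int (Suc i)) a'))"
          using borcherds[of p x "m - p" b n a'] by (simp add: algebra_simps)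
        also have "Sum_any (\<lambda>i::nat. (of_int p gchoose i) *\<^sub>C Y (Y x (m - p + int i) b) (p + n - int i) a')
            = (\<Sum>i<I. (of_int p gchoose i) *\<^sub>C Y (Y x (m - p + int i) b) (p + n - int i) a')"
          by (rule Sum_any_eq_lessThan) (use I in simp)
        also have "\<dots> - (\<Sum>i<nat (M - n). ((- 1) ^ Suc i * (of_int (m - p) gchoose Suc i))
            *\<^sub>C Y x (m - int (Suc i)) (Y b (n + int (Suc i)) a')) \<in> S"
        proof (intro cvec.subspace_diff[OF S] cvec.subspace_sum[OF S] cvec.subspace_scale[OF S])
          show "Y (Y x (m - p + int i) b) (p + n - int i) a' \<in> S" for i
            by (auto simp: S_def intro: cvec.span_base)
          show "Y x (m - int (Suc i)) (Y b (n + int (Suc i)) a') \<in> S" if "i \<in> {..<nat (M - n)}" for i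
            using less[of "n + int (Suc i)"] that by auto
        qed
        finally show "Y x m (Y b n a') \<in> S" .
      qed
    qed
    then show ?thesis by blast
  qed
  have left: "Y x m u \<in> S" if "u \<in> S" for x m u
    using that unfolding S_def
  proof (induction rule: cvec.span_induct_alt)
    case base
    show ?case by (simp add: cvec.span_zero)
  next
    case (step c u y)
    then show ?case
      using prod by (auto simp: Y_lin S_def intro!: cvec.span_add cvec.span_scale)
  qed
  have "vertex_ideal Y S" by (rule left_ideal_imp_vertex_ideal[OF S left])
  moreover have "Y vac (- 1) a' \<in> S" unfolding S_def by (rule cvec.span_base) blast
  then have "a' \<in> S" by (simp add: vacuum)
  ultimately have "S = UNIV" using simple a'(2) by (auto simp: simple_vertex_algebra_def)
  \<comment> \<open>Otherwise every product a_(n) a' would lie in the sum of the spaces of nonzero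
    weight, which does not contain the vacuum.\<close>
  have "\<exists>a k n. a \<in> weight_space Y \<omega> k \<and> k + d - n - 1 = 0 \<and> Y a n a' \<noteq> 0"
  proof (rule ccontr)
    assume none: "\<not> ?thesis"
    define T where "T = (\<Union>k\<in>-{0}. weight_space Y \<omega> k)"
    have hom: "Y a n a' \<in> cspan T" if a: "a \<in> weight_space Y \<omega> k" for a k n
    proof (cases "Y a n a' = 0")
      case False
      with none a have "k + d - n - 1 \<noteq> 0" by blast
      with weight_space_product[OF a a'(1), of n] show ?thesis
        by (intro cvec.span_base) (auto simp: T_def)
    qed (simp add: cvec.span_zero)
    have "Y a n a' \<in> cspan T" for a n
    proof -
      obtain F f where F: "finite F" "\<forall>k\<in>F. f k \<in> weight_space Y \<omega> k" "a = (\<Sum>k\<in>F. f k)"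
        using weight_decomposition[of a UNIV] grading by auto
      have "Y (sum f F) n a' = (\<Sum>k\<in>F. Y (f k) n a')"
        by (induction F rule: infinite_finite_induct) (simp_all add: Y_lin)
      then show ?thesis using F hom by (auto intro!: cvec.span_sum)
    qed
    then have "cspan T = UNIV"
      using \<open>S = UNIV\<close> cvec.span_minimal[of "{Y a n a' | a n. True}" "cspan T"] by (auto simp: S_def)
    then have "vac \<in> cspan T" by simp
    then have "\<exists>F f. finite F \<and> 0 \<notin> F \<and> (\<forall>k\<in>F. f k \<in> weight_space Y \<omega> k) \<and> vac = (\<Sum>k\<in>F. f k)"
      using weight_decomposition[of vac "- {0}"] unfolding T_def by blast
    then obtain F f where F: "finite F" "0 \<notin> F" "\<forall>k\<in>F. f k \<in> weight_space Y \<omega> k" "vac = (\<Sum>k\<in>F. f k)"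
      by blast
    \<comment> \<open>Moving the vacuum to the other side gives a vanishing sum over distinct
      weights, with 0 among them.\<close>
    let ?g = "f(0 := - vac)"
    have "?g 0 = 0"
    proof (rule weight_space_independent[of "insert 0 F" ?g 0])
      have "sum ?g F = sum f F" using F(2) by (intro sum.cong) auto
      then show "sum ?g (insert 0 F) = 0" using F by simp
      show "?g k \<in> weight_space Y \<omega> k" if "k \<in> insert 0 F" for k
        using that F vac0 cvec.subspace_neg[OF csubspace_weight_space] by auto
    qed (use F in auto)
    with \<open>vac \<noteq> 0\<close> show False by simp
  qed
  then obtain a k n where a: "a \<in> weight_space Y \<omega> k" "k + d - n - 1 = 0" "Y a n a' \<noteq> 0" by blast
  have "a \<noteq> 0" using a(3) by auto
  then have "k \<ge> 0" using neg[of k] a(1) by (cases "k < 0") auto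
  \<comment> \<open>Here n = k + d - 1, and d > 0 is what excludes the trivial solution vac_(-1) vac
    = vac.\<close>
  with a(2) d(1) have n: "n \<ge> 0" by simp
  have "Y a n a' \<in> weight_space Y \<omega> 0"
    using weight_space_product[OF a(1) a'(1), of n] a(2) by simp
  then obtain c where c: "Y a n a' = c *\<^sub>C vac"
    using w0 by (auto simp: cvec.span_singleton)
  with a(3) have "c \<noteq> 0" by auto
  have "Y ((1 / c) *\<^sub>C a) (int (nat n)) a' = vac"
    using n c \<open>c \<noteq> 0\<close> by (simp add: Y_lin cvec.scale_one)
  moreover have "Y ((1 / c) *\<^sub>C a) (int i) a' = 0" if "i > nat n" for i
    using weight_space_product[OF a(1) a'(1), of "int i"] neg[of "k + d - int i - 1"] that n a(2)
    by (auto simp: Y_lin)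
  ultimately show ?thesis by blast
qed

end

section \<open>Exchange relations for skew forms\<close>

text \<open>Linear functionals on \<open>R(T\<^sup>2(V)\<^bsup>S\<^sub>2\<^esup>)\<close> are such forms: see \<open>tensor_sym_skew\<close>.\<close>

locale coinvariant_form = vertex_operator_algebra Y vac \<omega>
  for Y :: "'v::complex_vector \<Rightarrow> int \<Rightarrow> 'v \<Rightarrow> 'v" and vac \<omega> :: 'v +
  fixes \<phi> :: "'v \<Rightarrow> 'v \<Rightarrow> complex"
  assumes form_add_left: "\<phi> (u + u') v = \<phi> u v + \<phi> u' v"
    and form_add_right: "\<phi> u (v + v') = \<phi> u v + \<phi> u v'"
    and form_scale_left: "\<phi> (c *\<^sub>C u) v = c * \<phi> u v"
    and form_scale_right: "\<phi> u (c *\<^sub>C v) = c * \<phi> u v"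
    and form_skew: "k \<le> - 2 \<Longrightarrow> \<phi> (Y x k u) v = - \<phi> u (Y x k v)"
begin

lemma form_zero_left [simp]: "\<phi> 0 v = 0" and form_zero_right [simp]: "\<phi> u 0 = 0"
  using form_scale_left[of 0 0 v] form_scale_right[of u 0 0] by simp_all

lemma form_diff_left: "\<phi> (u - u') v = \<phi> u v - \<phi> u' v"
  using form_add_left[of "u - u'" u' v] by (simp add: algebra_simps)

lemma form_diff_right: "\<phi> u (v - v') = \<phi> u v - \<phi> u v'"
  using form_add_right[of u "v - v'" v'] by (simp add: algebra_simps)

lemma form_sum_left: "\<phi> (sum f A) v = (\<Sum>i\<in>A. \<phi> (f i) v)"
  by (induction A rule: infinite_finite_induct) (simp_all add: form_add_left)

lemma form_sum_right: "\<phi> u (sum f A) = (\<Sum>i\<in>A. \<phi> u (f i))"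
  by (induction A rule: infinite_finite_induct) (simp_all add: form_add_right)

lemmas form_lin = form_add_left form_add_right form_diff_left form_diff_right
  form_scale_left form_scale_right form_sum_left form_sum_right

text \<open>The modes on the product side of the Borcherds identity are at most p + q <= -2, so both
  sides act as a skew operator. Skewness of the outer modes then brings every term to the form in
  which the outer mode acts on the first entry.\<close>

lemma form_exchange:
  assumes pq: "p + q \<le> - 2" and p: "p - int g - 1 \<le> - 2" and q: "q - int g - 1 \<le> - 2"
    and L: "\<And>i w. i \<ge> L \<Longrightarrow> w \<in> {u, v} \<Longrightarrow> Y a (p + int i) w = 0"
      "\<And>i w. i \<ge> L \<Longrightarrow> w \<in> {u, v} \<Longrightarrow> Y b (q + int i) w = 0"
  shows "(\<Sum>i<L. of_nat ((g + i) choose i) *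
      (\<phi> (Y a (p - int g - 1 - int i) (Y b (q + int i) u)) v
       - \<phi> (Y a (p - int g - 1 - int i) u) (Y b (q + int i) v)))
    = (- 1) ^ Suc g * (\<Sum>i<L. of_nat ((g + i) choose i) *
      (\<phi> (Y b (q - int g - 1 - int i) (Y a (p + int i) u)) v
       - \<phi> (Y b (q - int g - 1 - int i) u) (Y a (p + int i) v)))"
proof -
  obtain I where I: "\<forall>i\<ge>I. Y a (- int g - 1 + int i) b = 0" using truncation_nat by blast
  define R where "R w = (\<Sum>i<L. of_nat ((g + i) choose i) *\<^sub>C
         (Y a (p - int g - 1 - int i) (Y b (q + int i) w)
          - ((- 1) ^ Suc g) *\<^sub>C Y b (q - int g - 1 - int i) (Y a (p + int i) w)))" for w
  have R: "R w = (\<Sum>i<I. (of_int p gchoose i) *\<^sub>C Y (Y a (int i - int g - 1) b) (p + q - int i) w)"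
    if "w \<in> {u, v}" for w
    unfolding R_def
    by (rule borcherds_finite[symmetric]) (use L[OF _ that] I in \<open>auto simp: algebra_simps\<close>)
  have "\<phi> (R u) v = - \<phi> u (R v)"
    unfolding R[of u, simplified] R[of v, simplified] form_lin sum_negf[symmetric]
    by (rule sum.cong[OF refl]) (use pq in \<open>simp add: form_skew\<close>)
  moreover have "\<phi> (R u) v + \<phi> u (R v) =
    (\<Sum>i<L. of_nat ((g + i) choose i) *
      (\<phi> (Y a (p - int g - 1 - int i) (Y b (q + int i) u)) v
       - \<phi> (Y a (p - int g - 1 - int i) u) (Y b (q + int i) v)))
    - (- 1) ^ Suc g * (\<Sum>i<L. of_nat ((g + i) choose i) *
      (\<phi> (Y b (q - int g - 1 - int i) (Y a (p + int i) u)) v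
       - \<phi> (Y b (q - int g - 1 - int i) u) (Y a (p + int i) v)))"
    unfolding R_def form_lin sum_distrib_left sum.distrib[symmetric] sum_subtractf[symmetric]
  proof (rule sum.cong[OF refl], goal_cases)
    case (1 i)
    have "\<phi> (Y a (p - int g - 1 - int i) u) (Y b (q + int i) v)
        = - \<phi> u (Y a (p - int g - 1 - int i) (Y b (q + int i) v))"
      by (rule form_skew) (use p in simp)
    moreover have "\<phi> (Y b (q - int g - 1 - int i) u) (Y a (p + int i) v)
        = - \<phi> u (Y b (q - int g - 1 - int i) (Y a (p + int i) v))"
      by (rule form_skew) (use q in simp)
    ultimately show ?case by (simp only:) (simp add: algebra_simps)
  qed
  moreover have "A = - B \<Longrightarrow> A + B = C - D \<Longrightarrow> C = D" for A B C D :: complex by simp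
  ultimately show ?thesis by blast
qed

text \<open>In \<open>Theta\<close>, \<open>Y z l\<close> and then \<open>Y y k\<close> act on the pair \<open>(u, v)\<close> by the difference of the
  actions on the two entries, and finally \<open>Y x m\<close> acts on the first entry alone.\<close>

definition Theta :: "'v \<Rightarrow> 'v \<Rightarrow> 'v \<Rightarrow> int \<Rightarrow> 'v \<Rightarrow> int \<Rightarrow> 'v \<Rightarrow> int \<Rightarrow> complex"
  where "Theta u v x m y k z l =
    \<phi> (Y x m (Y y k (Y z l u))) v - \<phi> (Y x m (Y z l u)) (Y y k v)
    - \<phi> (Y x m (Y y k u)) (Y z l v) + \<phi> (Y x m u) (Y y k (Y z l v))"

definition Theta_comm :: "'v \<Rightarrow> 'v \<Rightarrow> 'v \<Rightarrow> int \<Rightarrow> 'v \<Rightarrow> int \<Rightarrow> complex"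
  where "Theta_comm u v x m y k = \<phi> (Y x m (Y y k u)) v + \<phi> (Y x m u) (Y y k v)"

text \<open>The mixed terms are the same in both orders and cancel. On the second entry the two
  minus signs multiply to +1, whence the plus sign in \<open>Theta_comm\<close>.\<close>

lemma Theta_swap:
  assumes "\<And>i. i \<ge> I \<Longrightarrow> Y y (int i) z = 0"
  shows "Theta u v x m y k z l - Theta u v x m z l y k
    = (\<Sum>i<I. (of_int k gchoose i) * Theta_comm u v x m (Y y (int i) z) (k + l - int i))"
proof -
  have c: "Y y k (Y z l w) = Y z l (Y y k w)
      + (\<Sum>i<I. (of_int k gchoose i) *\<^sub>C Y (Y y (int i) z) (k + l - int i) w)" for w
    using commutator[of I y z k l w] assms by (simp add: algebra_simps)
  show ?thesis
    unfolding Theta_def Theta_comm_def c[of u] c[of v]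
    by (simp add: Y_lin Y_sum_right form_lin sum.distrib algebra_simps)
qed

text \<open>Skewness carries \<open>Y y k\<close> from the second entry to the first, outside
  \<open>Y x m\<close>, and its sign turns the sum into a commutator.\<close>

lemma Theta_comm_eq_commutator:
  assumes "k \<le> - 2" "\<And>j. j \<ge> J \<Longrightarrow> Y x (int j) y = 0"
  shows "Theta_comm u v x m y k
    = (\<Sum>j<J. (of_int m gchoose j) * \<phi> (Y (Y x (int j) y) (m + k - int j) u) v)"
proof -
  have "\<phi> (Y x m u) (Y y k v) = - \<phi> (Y y k (Y x m u)) v"
    using form_skew[OF assms(1), of y "Y x m u" v] by simp
  then have "Theta_comm u v x m y k = \<phi> (Y x m (Y y k u) - Y y k (Y x m u)) v"
    by (simp add: Theta_comm_def form_lin)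
  also have "\<dots> = (\<Sum>j<J. (of_int m gchoose j) * \<phi> (Y (Y x (int j) y) (m + k - int j) u) v)"
    by (subst commutator[of J]) (simp_all add: assms(2) form_lin)
  finally show ?thesis .
qed

text \<open>\<open>Theta\<close> is the expression of \<open>form_exchange\<close> at the pair (c_l
  u, v) minus the one at (u, c_l v).\<close>

lemma Theta_exchange:
  assumes pq: "p + q \<le> - 2" and p: "p - int g - 1 \<le> - 2" and q: "q - int g - 1 \<le> - 2"
    and L: "\<And>i w. i \<ge> L \<Longrightarrow> w \<in> {u, v, Y c l u, Y c l v} \<Longrightarrow> Y a (p + int i) w = 0"
      "\<And>i w. i \<ge> L \<Longrightarrow> w \<in> {u, v, Y c l u, Y c l v} \<Longrightarrow> Y b (q + int i) w = 0"
  shows "(\<Sum>i<L. of_nat ((g + i) choose i) * Theta u v a (p - int g - 1 - int i) b (q + int i) c l)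
    = (- 1) ^ Suc g *
      (\<Sum>i<L. of_nat ((g + i) choose i) * Theta u v b (q - int g - 1 - int i) a (p + int i) c l)"
proof -
  have split: "(\<Sum>i<L. of_nat ((g + i) choose i) * Theta u v x (r - int g - 1 - int i) y (s + int i) c l)
    = (\<Sum>i<L. of_nat ((g + i) choose i) *
       (\<phi> (Y x (r - int g - 1 - int i) (Y y (s + int i) (Y c l u))) v
       - \<phi> (Y x (r - int g - 1 - int i) (Y c l u)) (Y y (s + int i) v)))
    - (\<Sum>i<L. of_nat ((g + i) choose i) *
       (\<phi> (Y x (r - int g - 1 - int i) (Y y (s + int i) u)) (Y c l v)
       - \<phi> (Y x (r - int g - 1 - int i) u) (Y y (s + int i) (Y c l v))))" for x y r s
    by (simp add: Theta_def algebra_simps sum.distrib sum_subtractf)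
  show ?thesis
    unfolding split
    by (subst form_exchange[OF pq p q, where u = "Y c l u" and v = v], use L in blast, use L in blast,
        subst form_exchange[OF pq p q, where u = u and v = "Y c l v"], use L in blast, use L in blast)
       (simp only: right_diff_distrib)
qed

end

section \<open>Eventual vanishing\<close>

context coinvariant_form
begin

text \<open>One bound serves all l at once; used for both orders of the two modes, it confines a
  double sum of \<open>Theta\<close> terms to a square.\<close>

definition truncates :: "'v \<Rightarrow> 'v \<Rightarrow> 'v \<Rightarrow> int \<Rightarrow> 'v \<Rightarrow> int \<Rightarrow> nat \<Rightarrow> bool"
  where "truncates u v a p c r L \<longleftrightarrow> (\<forall>w\<in>{u, v}. \<forall>k\<ge>L. \<forall>l::nat.
    Y a (p + int k) w = 0 \<and> Y a (p + int k) (Y c (r + int l) w) = 0)"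

text \<open>Row l is the exchange relation with g = h + l, multiplied by (h + l)! / l!. The
  dependence of g on l is the source of the sign (-1)^l.\<close>

lemma Theta_double_exchange:
  assumes pq: "p + q \<le> - 2" and p: "p - int h - 1 \<le> - 2" and q: "q - int h - 1 \<le> - 2"
    and a: "truncates u v a p c r L" and b: "truncates u v b q c r L"
  shows "(\<Sum>l<L. \<Sum>k<L. fact_coeff h k l *
      Theta u v b (q - int h - 1 - int (k + l)) a (p + int k) c (r + int l))
    = (- 1) ^ Suc h * (\<Sum>l<L. \<Sum>k<L. fact_coeff h k l * ((- 1) ^ l *
      Theta u v a (p - int h - 1 - int (k + l)) b (q + int k) c (r + int l)))"
  unfolding sum_distrib_left[of "(- 1) ^ Suc h"]
proof (rule sum.cong[OF refl])
  fix l :: nat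
  have idx: "x - int (h + l) - 1 - int k = x - int h - 1 - int (k + l)" for x k by simp
  have "(\<Sum>k<L. of_nat ((h + l + k) choose k) *
        Theta u v a (p - int h - 1 - int (k + l)) b (q + int k) c (r + int l))
      = (- 1) ^ Suc (h + l) * (\<Sum>k<L. of_nat ((h + l + k) choose k) *
        Theta u v b (q - int h - 1 - int (k + l)) a (p + int k) c (r + int l))"
    by (rule Theta_exchange[OF pq, of "h + l", unfolded idx])
       (use p q a b in \<open>auto simp: truncates_def\<close>)
  then have "(- 1) ^ Suc (h + l) * (fact (h + l) / fact l) * (\<Sum>k<L. of_nat ((h + l + k) choose k) *
        Theta u v a (p - int h - 1 - int (k + l)) b (q + int k) c (r + int l))
      = (fact (h + l) / fact l) * (\<Sum>k<L. of_nat ((h + l + k) choose k) *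
        Theta u v b (q - int h - 1 - int (k + l)) a (p + int k) c (r + int l))"
    by (simp add: mult.assoc[symmetric] power_mult_distrib[symmetric])
  then show "(\<Sum>k<L. fact_coeff h k l *
        Theta u v b (q - int h - 1 - int (k + l)) a (p + int k) c (r + int l))
      = (\<Sum>k<L. (- 1) ^ Suc h * (fact_coeff h k l * ((- 1) ^ l *
        Theta u v a (p - int h - 1 - int (k + l)) b (q + int k) c (r + int l))))"
    unfolding fact_coeff_row sum_distrib_left by (simp add: power_add mult_ac)
qed

text \<open>The modes involve p, q, r only through p + q + r. With that sum held fixed, the
  dependence on p and q is polynomial, through the two generalized binomial coefficients.\<close>

definition nested_sum ::
  "'v \<Rightarrow> 'v \<Rightarrow> nat \<Rightarrow> nat \<Rightarrow> nat \<Rightarrow> nat \<Rightarrow> 'v \<Rightarrow> int \<Rightarrow> 'v \<Rightarrow> int \<Rightarrow> 'v \<Rightarrow> int \<Rightarrow> complex"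
  where "nested_sum u v h L I J a p b q c r = (\<Sum>N<2*L. \<Sum>i<I. \<Sum>j<J. if N \<le> i then
      (fact_ratio h N * \<phi> (Y (Y a (int j) (Y b (int i) c)) (p + q + r - int h - 1 - int i - int j) u) v) *
      ((of_int q gchoose (i - N)) * (of_int (p - int h - 1 - int N) gchoose j)) else 0)"

text \<open>Summing along a diagonal \<open>k + l = N\<close>, the signs produce an \<open>N\<close>-th difference of the binomial
  coefficients in the commutator formula, which leaves only modes \<open>\<le> - 2\<close> of \<open>Y b i c\<close>.\<close>

lemma alternating_sum_eq_nested_sum:
  assumes qr: "q + r \<le> - 2"
    and bc: "truncates u v b q c r L" and cb: "truncates u v c r b q L"
    and b: "\<And>k w. w \<in> {u, v} \<Longrightarrow> Y b (q + int k) w = 0"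
    and I: "\<And>i. i \<ge> I \<Longrightarrow> Y b (int i) c = 0"
    and J: "\<And>i j. i < I \<Longrightarrow> j \<ge> J \<Longrightarrow> Y a (int j) (Y b (int i) c) = 0"
  shows "(\<Sum>l<L. \<Sum>k<L. fact_coeff h k l * ((- 1) ^ l *
      Theta u v a (p - int h - 1 - int (k + l)) b (q + int k) c (r + int l)))
    = nested_sum u v h L I J a p b q c r"
proof -
  have "(\<Sum>l<L. \<Sum>k<L. fact_coeff h k l * ((- 1) ^ l *
      Theta u v a (p - int h - 1 - int (k + l)) b (q + int k) c (r + int l)))
    = (\<Sum>N<2*L. \<Sum>k\<le>N. fact_coeff h k (N - k) * ((- 1) ^ (N - k) *
      Theta u v a (p - int h - 1 - int (k + (N - k))) b (q + int k) c (r + int (N - k))))"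
    by (rule sum_square_eq_sum_diagonals) (use bc cb in \<open>auto simp: Theta_def truncates_def\<close>)
  also have "\<dots> = nested_sum u v h L I J a p b q c r"
    unfolding nested_sum_def
  proof (rule sum.cong[OF refl])
    fix N :: nat
    let ?T = "\<lambda>i. Theta_comm u v a (p - int h - 1 - int N) (Y b (int i) c) (q + r + int N - int i)"
    have "Theta u v a (p - int h - 1 - int N) b (q + int k) c (r + int (N - k))
        = (\<Sum>i<I. (of_int (q + int k) gchoose i) * ?T i)" if "k \<le> N" for k
    proof -
      \<comment> \<open>In this order b acts first, and it annihilates u and v, so only the
        commutator of b and c remains.\<close>
      have "Theta u v a (p - int h - 1 - int N) c (r + int (N - k)) b (q + int k) = 0"
        using b by (simp add: Theta_def)
      with Theta_swap[OF I, of I u v a "p - int h - 1 - int N" "q + int k" "r + int (N - k)"]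
      show ?thesis using that by (simp add: algebra_simps)
    qed
    then have "(\<Sum>k\<le>N. fact_coeff h k (N - k) * ((- 1) ^ (N - k) *
        Theta u v a (p - int h - 1 - int (k + (N - k))) b (q + int k) c (r + int (N - k))))
      = (\<Sum>k\<le>N. \<Sum>i<I. fact_ratio h N * ?T i *
          ((- 1) ^ (N - k) * of_nat (N choose k) * ((of_int q + of_nat (0 + k)) gchoose i)))"
      by (intro sum.cong[OF refl]) (simp add: fact_coeff_diagonal sum_distrib_left mult_ac)
    also have "\<dots> = (\<Sum>i<I. fact_ratio h N * ?T i *
          (fdiff ^^ N) (\<lambda>n. (of_int q + of_nat n) gchoose i) 0)"
      unfolding fdiff_pow_expand sum_distrib_left by (rule sum.swap)
    also have "\<dots> = (\<Sum>i<I. \<Sum>j<J. if N \<le> i then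
      (fact_ratio h N * \<phi> (Y (Y a (int j) (Y b (int i) c)) (p + q + r - int h - 1 - int i - int j) u) v) *
      ((of_int q gchoose (i - N)) * (of_int (p - int h - 1 - int N) gchoose j)) else 0)"
    proof (rule sum.cong[OF refl])
      fix i assume i: "i \<in> {..<I}"
      show "fact_ratio h N * ?T i * (fdiff ^^ N) (\<lambda>n. (of_int q + of_nat n) gchoose i) 0
        = (\<Sum>j<J. if N \<le> i then
      (fact_ratio h N * \<phi> (Y (Y a (int j) (Y b (int i) c)) (p + q + r - int h - 1 - int i - int j) u) v) *
      ((of_int q gchoose (i - N)) * (of_int (p - int h - 1 - int N) gchoose j)) else 0)"
      proof (cases "N \<le> i")
        case True
        have idx: "p - int h - 1 - int N + (q + r + int N - int i) - int j
            = p + q + r - int h - 1 - int i - int j" for j by simp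
        have "?T i = (\<Sum>j<J. (of_int (p - int h - 1 - int N) gchoose j) *
            \<phi> (Y (Y a (int j) (Y b (int i) c)) (p + q + r - int h - 1 - int i - int j) u) v)"
          unfolding idx[symmetric]
          by (rule Theta_comm_eq_commutator) (use True qr J i in auto)
        with True show ?thesis
          by (simp only: fdiff_pow_gbinomial if_True) (simp add: sum_distrib_left sum_distrib_right mult_ac)
      qed (simp add: fdiff_pow_gbinomial)
    qed
    finally show "(\<Sum>k\<le>N. fact_coeff h k (N - k) * ((- 1) ^ (N - k) *
        Theta u v a (p - int h - 1 - int (k + (N - k))) b (q + int k) c (r + int (N - k))))
      = (\<Sum>i<I. \<Sum>j<J. if N \<le> i then
      (fact_ratio h N * \<phi> (Y (Y a (int j) (Y b (int i) c)) (p + q + r - int h - 1 - int i - int j) u) v) *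
      ((of_int q gchoose (i - N)) * (of_int (p - int h - 1 - int N) gchoose j)) else 0)" .
  qed
  finally show ?thesis .
qed

text \<open>The double sums with b outermost, for the two orders of a and c, have equal weights and
  equal outer modes. Their difference consists of commutators of a with c, while each of them
  separately is a nested sum after one double exchange.\<close>

lemma commutator_sum_eq_nested_sums:
  assumes pq: "p + q \<le> - 2" and rq: "r + q \<le> - 2"
    and h: "p - int h - 1 \<le> - 2" "q - int h - 1 \<le> - 2" "r - int h - 1 \<le> - 2"
    and tr: "truncates u v a p c r L" "truncates u v c r a p L" "truncates u v b q c r L"
      "truncates u v c r b q L" "truncates u v b q a p L" "truncates u v a p b q L"
    and b: "\<And>k w. w \<in> {u, v} \<Longrightarrow> Y b (q + int k) w = 0"
    and I: "\<And>i. i \<ge> I \<Longrightarrow> Y b (int i) c = 0" "\<And>i. i \<ge> I \<Longrightarrow> Y b (int i) a = 0"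
    and J: "\<And>i j. i < I \<Longrightarrow> j \<ge> J \<Longrightarrow> Y a (int j) (Y b (int i) c) = 0"
      "\<And>i j. i < I \<Longrightarrow> j \<ge> J \<Longrightarrow> Y c (int j) (Y b (int i) a) = 0"
    and E: "\<And>i. i \<ge> E \<Longrightarrow> Y a (int i) c = 0"
  shows "(\<Sum>N<2*L. \<Sum>i<E. (fact_ratio h N *
      Theta_comm u v b (q - int h - 1 - int N) (Y a (int i) c) (p + r + int N - int i)) *
      (\<Sum>k\<le>N. of_nat (N choose k) * (of_int (p + int k) gchoose i)))
    = (- 1) ^ Suc h * (nested_sum u v h L I J a p b q c r - nested_sum u v h L I J c r b q a p)"
proof -
  let ?m = "\<lambda>n. q - int h - 1 - int n"
  have "(\<Sum>l<L. \<Sum>k<L. fact_coeff h k l * Theta u v b (?m (k + l)) a (p + int k) c (r + int l))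
      = (- 1) ^ Suc h * nested_sum u v h L I J a p b q c r"
    by (subst Theta_double_exchange[OF pq h(1,2) tr(1,3)])
       (subst alternating_sum_eq_nested_sum[OF _ tr(3,4) b I(1) J(1)]; use rq in simp)
  moreover have "(\<Sum>l<L. \<Sum>k<L. fact_coeff h k l * Theta u v b (?m (k + l)) c (r + int l) a (p + int k))
      = (- 1) ^ Suc h * nested_sum u v h L I J c r b q a p"
  proof -
    have "(\<Sum>l<L. \<Sum>k<L. fact_coeff h k l * Theta u v b (?m (k + l)) c (r + int l) a (p + int k))
      = (\<Sum>k<L. \<Sum>l<L. fact_coeff h l k * Theta u v b (?m (l + k)) c (r + int l) a (p + int k))"
      by (subst sum.swap) (simp add: fact_coeff_commute[of h] add.commute)
    also have "\<dots> = (- 1) ^ Suc h * nested_sum u v h L I J c r b q a p"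
      by (subst Theta_double_exchange[OF rq h(3,2) tr(2,5)])
         (subst alternating_sum_eq_nested_sum[OF _ tr(5,6) b I(2) J(2)]; use pq in simp)
    finally show ?thesis .
  qed
  moreover have "(\<Sum>l<L. \<Sum>k<L. fact_coeff h k l * Theta u v b (?m (k + l)) a (p + int k) c (r + int l))
      - (\<Sum>l<L. \<Sum>k<L. fact_coeff h k l * Theta u v b (?m (k + l)) c (r + int l) a (p + int k))
    = (\<Sum>N<2*L. \<Sum>i<E. (fact_ratio h N *
      Theta_comm u v b (?m N) (Y a (int i) c) (p + r + int N - int i)) *
      (\<Sum>k\<le>N. of_nat (N choose k) * (of_int (p + int k) gchoose i)))"
  proof -
    let ?D = "\<lambda>k l. Theta u v b (?m (k + l)) a (p + int k) c (r + int l)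
        - Theta u v b (?m (k + l)) c (r + int l) a (p + int k)"
    have "(\<Sum>l<L. \<Sum>k<L. fact_coeff h k l * Theta u v b (?m (k + l)) a (p + int k) c (r + int l))
        - (\<Sum>l<L. \<Sum>k<L. fact_coeff h k l * Theta u v b (?m (k + l)) c (r + int l) a (p + int k))
      = (\<Sum>l<L. \<Sum>k<L. fact_coeff h k l * ?D k l)"
      by (simp add: sum_subtractf right_diff_distrib)
    also have "\<dots> = (\<Sum>N<2*L. \<Sum>k\<le>N. fact_coeff h k (N - k) * ?D k (N - k))"
      by (rule sum_square_eq_sum_diagonals) (use tr in \<open>auto simp: Theta_def truncates_def\<close>)
    also have "\<dots> = (\<Sum>N<2*L. \<Sum>k\<le>N. \<Sum>i<E. (fact_ratio h N *
        Theta_comm u v b (?m N) (Y a (int i) c) (p + r + int N - int i)) *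
        (of_nat (N choose k) * (of_int (p + int k) gchoose i)))"
    proof (intro sum.cong[OF refl])
      fix N k :: nat assume "k \<in> {..N}"
      then have k: "k \<le> N" by simp
      have "?D k (N - k) = (\<Sum>i<E. (of_int (p + int k) gchoose i) *
          Theta_comm u v b (?m N) (Y a (int i) c) (p + r + int N - int i))"
        using Theta_swap[OF E, of E u v b "?m N" "p + int k" "r + int (N - k)"] k
        by (simp add: algebra_simps)
      then show "fact_coeff h k (N - k) * ?D k (N - k) = (\<Sum>i<E. (fact_ratio h N *
          Theta_comm u v b (?m N) (Y a (int i) c) (p + r + int N - int i)) *
          (of_nat (N choose k) * (of_int (p + int k) gchoose i)))"
        by (simp only: fact_coeff_diagonal[OF k]) (simp add: sum_distrib_left mult_ac)
    qed
    also have "\<dots> = (\<Sum>N<2*L. \<Sum>i<E. (fact_ratio h N *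
      Theta_comm u v b (?m N) (Y a (int i) c) (p + r + int N - int i)) *
      (\<Sum>k\<le>N. of_nat (N choose k) * (of_int (p + int k) gchoose i)))"
      unfolding sum_distrib_left by (intro sum.cong[OF refl]) (rule sum.swap)
    finally show ?thesis .
  qed
  ultimately show ?thesis by (simp add: right_diff_distrib)
qed

section \<open>Common truncation bounds and the separation of the contraction\<close>

lemma truncates_mono:
  assumes "truncates u v a p c r L" "p \<le> p'" "r \<le> r'"
  shows "truncates u v a p' c r' L"
  unfolding truncates_def
proof (intro ballI allI impI)
  fix w k l assume w: "w \<in> {u, v}" and k: "k \<ge> L"
  have "p' + int k = p + int (nat (p' - p) + k)" "r' + int l = r + int (nat (r' - r) + l)"
    using assms by auto
  then show "Y a (p' + int k) w = 0 \<and> Y a (p' + int k) (Y c (r' + int l) w) = 0"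
    using assms(1) w k unfolding truncates_def by (metis trans_le_add2)
qed

lemma truncates_mono_bound: "truncates u v a p c r L \<Longrightarrow> L \<le> L' \<Longrightarrow> truncates u v a p c r L'"
  by (auto simp: truncates_def)

text \<open>Only finitely many of the vectors c_(r + l) w are nonzero, so finitely many vectors have
  to be truncated by a.\<close>

lemma ex_truncates: "\<exists>L. truncates u v a p c r L"
proof -
  obtain M where M: "\<forall>w\<in>{u, v}. \<forall>i\<ge>M. Y c (r + int i) w = 0"
    using truncation_finite[of "{u, v}"] by blast
  let ?W = "{u, v} \<union> (\<lambda>(l, w). Y c (r + int l) w) ` ({..<M} \<times> {u, v})"
  have "finite ?W" by simp
  then obtain L where L: "\<forall>w\<in>?W. \<forall>i\<ge>L. Y a (p + int i) w = 0"
    using truncation_finite by blast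
  have "Y a (p + int k) (Y c (r + int l) w) = 0" if "w \<in> {u, v}" "k \<ge> L" for w k l
  proof (cases "l < M")
    case True
    then have "Y c (r + int l) w \<in> ?W" using that by force
    with L that show ?thesis by blast
  qed (use M that in auto)
  with L show ?thesis by (intro exI[of _ L]) (auto simp: truncates_def)
qed

text \<open>In \<open>commutator_sum_eq_nested_sums\<close> keep \<open>p + q + r = - B\<close> fixed. The \<open>e\<close>-th difference in \<open>p\<close>
  extracts the contraction \<open>Y a e c = vac\<close> on the left; the \<open>D\<close>-th difference in \<open>q\<close> kills the
  right-hand side, which is polynomial in \<open>q\<close>.\<close>

lemma form_product_vanishes:
  fixes q0 :: nat
  assumes ac: "Y a (int e) c = vac" "\<And>i. i > e \<Longrightarrow> Y a (int i) c = 0"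
    and b: "\<And>k w. w \<in> {u, v} \<Longrightarrow> Y b (int q0 + int k) w = 0"
    and I: "\<And>i. i \<ge> I \<Longrightarrow> Y b (int i) c = 0" "\<And>i. i \<ge> I \<Longrightarrow> Y b (int i) a = 0"
    and J: "\<And>i j. i < I \<Longrightarrow> j \<ge> J \<Longrightarrow> Y a (int j) (Y b (int i) c) = 0"
      "\<And>i j. i < I \<Longrightarrow> j \<ge> J \<Longrightarrow> Y c (int j) (Y b (int i) a) = 0"
    and D: "D = I + J" and B: "B = int (4 + q0 + D + e)" and h: "h \<ge> q0 + D + 1"
  shows "\<phi> (Y b (- int h - B - int e) u) v = 0"
proof -
  \<comment> \<open>For s <= e and t <= D this gives p + q <= -2, and the value of B makes r + q
    equal to -2 - s.\<close>
  define p where "p s = - 2 - int q0 - int D - int e + int s" for s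
  define q where "q t = int q0 + int t" for t
  define r where "r s t = - B - p s - q t" for s t
  \<comment> \<open>This is B + q + e - 1, the diagonal on which the mode p + r + N - e of a_(e) c
    is -1.\<close>
  define N where "N t = 3 + 2 * q0 + D + 2 * e + t" for t :: nat
  \<comment> \<open>The least values of p, r and q in the range, so that one truncation bound covers
    all parameters.\<close>
  define p1 where "p1 = p 0"
  define r1 where "r1 = r e D"
  define q1 where "q1 = int q0"
  obtain L1 L2 L3 L4 L5 L6 where L': "truncates u v a p1 c r1 L1" "truncates u v c r1 a p1 L2"
      "truncates u v b q1 c r1 L3" "truncates u v c r1 b q1 L4"
      "truncates u v b q1 a p1 L5" "truncates u v a p1 b q1 L6"
    using ex_truncates by meson
  \<comment> \<open>The summand \<open>N D\<close> keeps every diagonal \<open>N t\<close> with t <=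
    D inside the range below 2 L.\<close>
  define L where "L = N D + 1 + L1 + L2 + L3 + L4 + L5 + L6"
  have L: "truncates u v a p1 c r1 L" "truncates u v c r1 a p1 L"
      "truncates u v b q1 c r1 L" "truncates u v c r1 b q1 L"
      "truncates u v b q1 a p1 L" "truncates u v a p1 b q1 L"
    using L' by (auto intro: truncates_mono_bound simp: L_def)
  define V where "V s t = (- 1) ^ Suc h * (nested_sum u v h L I J a (p s) b (q t) c (r s t)
      - nested_sum u v h L I J c (r s t) b (q t) a (p s))" for s t
  \<comment> \<open>Independent of s, because p + r = - B - q: differencing in s touches only the
    binomial coefficients.\<close>
  define C where "C t n i = fact_ratio h n * Theta_comm u v b (q t - int h - 1 - int n)
      (Y a (int i) c) (- B - q t + int n - int i)" for t n i
  have main: "(\<Sum>n<2*L. \<Sum>i<Suc e. C t n i * (\<Sum>k\<le>n. of_nat (n choose k) * (of_int (p s + int k) gchoose i)))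
      = V s t" if st: "s \<le> e" "t \<le> D" for s t
  proof -
    have tr: "truncates u v a (p s) c (r s t) L" "truncates u v c (r s t) a (p s) L"
      "truncates u v b (q t) c (r s t) L" "truncates u v c (r s t) b (q t) L"
      "truncates u v b (q t) a (p s) L" "truncates u v a (p s) b (q t) L"
      by (rule L[THEN truncates_mono]; use st in \<open>simp add: p1_def q1_def r1_def p_def q_def r_def\<close>)+
    have bq: "Y b (q t + int k) w = 0" if "w \<in> {u, v}" for k w
      using b[OF that, of "t + k"] by (simp add: q_def add_ac)
    have pr: "p s + r s t + int n - int i = - B - q t + int n - int i" for n i
      by (simp add: r_def)
    show ?thesis
      unfolding V_def C_def pr[symmetric]
      by (rule commutator_sum_eq_nested_sums[OF _ _ _ _ _ tr bq I J])
         (use st h ac(2) in \<open>auto simp: p_def q_def r_def B\<close>)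
  qed
  have poly: "poly_deg_less D (V s)" for s
  proof -
    have e1: "p s + q t + r s t = - B" "r s t + q t + p s = - B" for t by (simp_all add: r_def)
    have e2: "of_int (r s t - int h - 1 - int n) = (of_int (- B - p s - int q0 - int h - 1 - int n) - of_nat t :: complex)"
      for t n by (simp add: r_def q_def)
    have e3: "of_int (q t) = (of_int (int q0) + of_nat t :: complex)" for t by (simp add: q_def)
    have if_poly: "poly_deg_less D (\<lambda>t. if P then f t else 0)" if "poly_deg_less D f"
      for P and f :: "nat \<Rightarrow> complex"
      using that poly_deg_less_cmult[OF that, of 0] by (cases P) simp_all
    show ?thesis
      unfolding V_def nested_sum_def e1 e2 e3 D
      by (intro poly_deg_less_cmult poly_deg_less_diff poly_deg_less_sum if_poly[unfolded D]
          poly_deg_less_gbinomial_prod) auto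
  qed
  define X where "X = \<phi> (Y b (- int h - B - int e) u) v"
  have diff_e: "(fdiff ^^ e) (\<lambda>s. V s t) 0 = 2 * X * (fact_ratio h (N 0 + t) * 2 ^ (N 0 + t))"
    if t: "t \<le> D" for t
  proof -
    have "(fdiff ^^ e) (\<lambda>s. V s t) 0 = (fdiff ^^ e) (\<lambda>s. \<Sum>n<2*L. \<Sum>i<Suc e. C t n i *
        (\<Sum>k\<le>n. of_nat (n choose k) * ((of_int (p1 + int k) + of_nat s) gchoose i))) 0"
      by (rule fdiff_pow_cong) (use t in \<open>simp add: main[symmetric] p1_def p_def add_ac del: sum.lessThan_Suc\<close>)
    \<comment> \<open>A binomial coefficient of degree i <= e has e-th difference 1 if i = e and 0
      otherwise.\<close>
    also have "\<dots> = (\<Sum>n<2*L. \<Sum>i<Suc e. C t n i * (\<Sum>k\<le>n. of_nat (n choose k) * (if i = e then 1 else 0)))"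
      unfolding fdiff_pow_sum fdiff_pow_mult fdiff_pow_gbinomial
      by (intro sum.cong refl arg_cong2[where f = "(*)"]) auto
    also have "\<dots> = (\<Sum>n<2*L. C t n e * 2 ^ n)"
    proof (rule sum.cong[OF refl])
      fix n
      have "(\<Sum>k\<le>n. of_nat (n choose k)) = (2 ^ n :: complex)"
        using arg_cong[OF choose_row_sum[of n], of "of_nat :: nat \<Rightarrow> complex"] by simp
      then show "(\<Sum>i<Suc e. C t n i * (\<Sum>k\<le>n. of_nat (n choose k) * (if i = e then 1 else 0))) = C t n e * 2 ^ n"
        by simp
    qed
    also have "\<dots> = (\<Sum>n<2*L. if n = N t then C t n e * 2 ^ n else 0)"
    proof (rule sum.cong[OF refl])
      fix n
      show "C t n e * 2 ^ n = (if n = N t then C t n e * 2 ^ n else 0)"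
      proof (cases "n = N t")
        case False
        then have "- B - q t + int n - int e \<noteq> - 1" by (auto simp: B q_def N_def)
        then have "C t n e = 0" by (simp add: C_def ac(1) Theta_comm_def vacuum)
        with False show ?thesis by simp
      qed simp
    qed
    also have "\<dots> = C t (N t) e * 2 ^ N t"
      using t by (simp add: L_def N_def)
    also have "C t (N t) e = fact_ratio h (N t) * (2 * X)"
    proof -
      \<comment> \<open>The growth of \<open>N t\<close> cancels that of q, so the outer mode of b
        is the same for all t.\<close>
      have e: "- B - q t + int (N t) - int e = - 1" "q t - int h - 1 - int (N t) = - int h - B - int e"
        by (auto simp: B q_def N_def)
      show ?thesis
        unfolding C_def ac(1) Theta_comm_def e by (simp add: vacuum X_def)
    qed
    finally show ?thesis by (simp add: N_def)
  qed
  have "2 * X * (fdiff ^^ D) (\<lambda>t. fact_ratio h (N 0 + t) * 2 ^ (N 0 + t)) 0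
      = (fdiff ^^ D) (\<lambda>t. 2 * X * (fact_ratio h (N 0 + t) * 2 ^ (N 0 + t))) 0"
    by (simp only: fdiff_pow_mult)
  also have "\<dots> = (fdiff ^^ D) (\<lambda>t. (fdiff ^^ e) (\<lambda>s. V s t) 0) 0"
    by (rule fdiff_pow_cong) (simp add: diff_e)
  also have "\<dots> = 0"
    using poly_deg_less_fdiff_pow[of D V e 0, OF poly] by (simp add: poly_deg_less_def)
  finally have "X = 0" using fdiff_pow_fact_ratio_nonzero by simp
  then show ?thesis by (simp add: X_def)
qed

end

text \<open>The bound is built from a, c, e and truncation bounds alone, hence serves all forms. If
  the vacuum spans the space, then b_(-m) is zero for m >= 2 and no contraction is called
  for.\<close>

lemma (in vertex_operator_algebra) coinvariant_form_vanishes: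
  assumes simple: "simple_vertex_algebra Y" and cft: "CFT_type Y vac \<omega>"
  shows "\<exists>M. \<forall>m\<ge>M. \<forall>\<phi>. coinvariant_form Y vac \<omega> \<phi> \<longrightarrow> \<phi> (Y b (- int m) u) v = 0"
proof (cases "cspan {vac} = UNIV")
  case True
  then obtain c where "b = c *\<^sub>C vac" by (metis UNIV_I cvec.span_singleton rangeE)
  then have "Y b (- int m) u = 0" if "m \<ge> 2" for m
    using that by (simp add: Y_lin vacuum)
  then show ?thesis
    by (intro exI[of _ 2]) (auto simp: coinvariant_form.form_zero_left)
next
  case False
  then obtain a c e where ac: "Y a (int e) c = vac" "\<And>i. i > e \<Longrightarrow> Y a (int i) c = 0"
    using exists_contraction[OF simple cft] by blast
  obtain Q where "\<forall>w\<in>{u, v}. \<forall>i\<ge>Q. Y b (0 + int i) w = 0"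
    using truncation_finite[of "{u, v}" b 0] by blast
  then have Q: "\<And>k w. w \<in> {u, v} \<Longrightarrow> Y b (int Q + int k) w = 0"
    by (metis add_0 le_add1 of_nat_add)
  obtain I where "\<forall>w\<in>{a, c}. \<forall>i\<ge>I. Y b (0 + int i) w = 0"
    using truncation_finite[of "{a, c}" b 0] by blast
  then have I: "\<And>i. i \<ge> I \<Longrightarrow> Y b (int i) c = 0" "\<And>i. i \<ge> I \<Longrightarrow> Y b (int i) a = 0"
    by simp_all
  obtain J1 where J1: "\<forall>w\<in>(\<lambda>i. Y b (int i) c) ` {..<I}. \<forall>i\<ge>J1. Y a (0 + int i) w = 0"
    using truncation_finite[of "(\<lambda>i. Y b (int i) c) ` {..<I}" a 0] by blast
  obtain J2 where J2: "\<forall>w\<in>(\<lambda>i. Y b (int i) a) ` {..<I}. \<forall>i\<ge>J2. Y c (0 + int i) w = 0"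
    using truncation_finite[of "(\<lambda>i. Y b (int i) a) ` {..<I}" c 0] by blast
  define J where "J = max J1 J2"
  have J: "\<And>i j. i < I \<Longrightarrow> j \<ge> J \<Longrightarrow> Y a (int j) (Y b (int i) c) = 0"
      "\<And>i j. i < I \<Longrightarrow> j \<ge> J \<Longrightarrow> Y c (int j) (Y b (int i) a) = 0"
    using J1 J2 by (auto simp: J_def)
  define D where "D = I + J"
  \<comment> \<open>This is B + e, so that m = h + K with h = m - K.\<close>
  define K where "K = 4 + Q + D + e + e"
  have "\<phi> (Y b (- int m) u) v = 0"
    if m: "m \<ge> K + Q + D + 1" and f: "coinvariant_form Y vac \<omega> \<phi>" for m \<phi>
  proof -
    have "- int m = - int (m - K) - int (4 + Q + D + e) - int e"
      using m by (simp add: K_def)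
    moreover have "\<phi> (Y b (- int (m - K) - int (4 + Q + D + e) - int e) u) v = 0"
      by (rule coinvariant_form.form_product_vanishes[OF f ac Q I J D_def refl]) (use m in simp_all)
    ultimately show ?thesis by (simp only:)
  qed
  then show ?thesis by blast
qed

section \<open>The symmetric square\<close>

lemma ex_separating_functional:
  assumes W: "csubspace W" and u: "u \<notin> W"
  shows "\<exists>\<xi> :: 'a::complex_vector \<Rightarrow> complex. (\<forall>x y. \<xi> (x + y) = \<xi> x + \<xi> y)
    \<and> (\<forall>c x. \<xi> (c *\<^sub>C x) = c * \<xi> x) \<and> (\<forall>w\<in>W. \<xi> w = 0) \<and> \<xi> u = 1"
proof -
  interpret pair: vector_space_pair "scaleC :: complex \<Rightarrow> 'a \<Rightarrow> 'a" "(*) :: complex \<Rightarrow> _ \<Rightarrow> _"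
    by unfold_locales (simp_all add: algebra_simps)
  obtain B where B: "B \<subseteq> W" "cvec.independent B" "W \<subseteq> cspan B"
    using cvec.maximal_independent_subset by blast
  have "u \<notin> cspan B" using cvec.span_minimal[OF B(1) W] u by blast
  then have "cvec.independent (insert u B)" "u \<notin> B"
    using B(2) by (auto simp: cvec.independent_insert intro: cvec.span_base)
  then obtain \<xi> where \<xi>: "Vector_Spaces.linear scaleC (*) \<xi>"
      "\<forall>x\<in>insert u B. \<xi> x = (if x = u then 1 else 0)"
    using pair.linear_independent_extend[of "insert u B" "\<lambda>x. if x = u then 1 else 0"] by blast
  have lin: "\<xi> (x + y) = \<xi> x + \<xi> y" "\<xi> (c *\<^sub>C x) = c * \<xi> x" for x y c
    using \<xi>(1) by (simp_all add: Vector_Spaces.linear_iff)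
  have "\<xi> w = 0" if "w \<in> cspan B" for w
    using that
  proof (induction rule: cvec.span_induct_alt)
    case base
    show ?case using lin(2)[of 0 0] by simp
  next
    case (step c x y)
    then show ?case using \<xi>(2) \<open>u \<notin> B\<close> by (auto simp: lin)
  qed
  then show ?thesis using lin \<xi>(2) B(3) by (intro exI[of _ \<xi>]) auto
qed

lemma coset_eq_coset_zero:
  assumes "csubspace W" "z \<in> W"
  shows "coset W z = coset W 0"
proof (intro set_eqI iffI)
  fix x assume "x \<in> coset W z"
  then show "x \<in> coset W 0"
    using cvec.subspace_add[OF assms(1,2)] by (auto simp: coset_def)
next
  fix x assume "x \<in> coset W 0"
  then have "x - z \<in> W" using cvec.subspace_diff[OF assms(1) _ assms(2)] by (auto simp: coset_def)
  then show "x \<in> coset W z" by (auto simp: coset_def intro: exI[of _ "x - z"])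
qed

text \<open>For v = vac this is \<open>eta vac u\<close>, so a form built from it recovers the
  values of a functional on \<open>eta\<close>.\<close>

definition tensor_sym :: "'v::complex_vector \<Rightarrow> 'v \<Rightarrow> ('v, 'v) tensor"
  where "tensor_sym u v = u \<otimes> v + v \<otimes> u"

context vertex_operator_algebra
begin

lemma tensor_square_prod_vac:
  "tensor_square_prod Y (x \<otimes> vac) n (u \<otimes> v) = Y x n u \<otimes> v"
  "tensor_square_prod Y (vac \<otimes> x) n (u \<otimes> v) = u \<otimes> Y x n v"
proof -
  have "Sum_any (\<lambda>i. Y x i u \<otimes> Y vac (n - 1 - i) v) = (\<Sum>i\<in>{n}. Y x i u \<otimes> Y vac (n - 1 - i) v)"
    by (rule Sum_any.expand_superset) (auto simp: vacuum split: if_splits)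
  then show "tensor_square_prod Y (x \<otimes> vac) n (u \<otimes> v) = Y x n u \<otimes> v"
    by (simp add: tensor_square_prod_pure_eq vacuum)
  have "Sum_any (\<lambda>i. Y vac i u \<otimes> Y x (n - 1 - i) v) = (\<Sum>i\<in>{-1}. Y vac i u \<otimes> Y x (n - 1 - i) v)"
    by (rule Sum_any.expand_superset) (auto simp: vacuum split: if_splits)
  then show "tensor_square_prod Y (vac \<otimes> x) n (u \<otimes> v) = u \<otimes> Y x n v"
    by (simp add: tensor_square_prod_pure_eq vacuum)
qed

lemma tensor_square_prod_eta:
  "tensor_square_prod Y (eta vac x) n (tensor_sym u v)
    = tensor_sym (Y x n u) v + tensor_sym u (Y x n v)"
  by (simp add: eta_def tensor_sym_def clinear_add[OF clinear_tensor_square_prod_left]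
      clinear_add[OF clinear_tensor_square_prod_right] tensor_square_prod_vac add_ac)

lemma tensor_sym_fixed: "tensor_sym u v \<in> S2_fixed"
  by (simp add: tensor_sym_def S2_fixed_def clinear_add[OF clinear_tensor_swap] tensor_swap_pure
      add.commute)

text \<open>The modes of \<open>eta vac x\<close> act as derivations on symmetric tensors, so mode
  -2 gives a generator of C_2. Lower modes follow by replacing x with L_{-1} x, at the cost of the
  nonzero factor j + 2.\<close>

lemma tensor_sym_skew:
  "tensor_sym (Y x (- 2 - int j) u) v + tensor_sym u (Y x (- 2 - int j) v) \<in> C2_sym Y"
proof (induction j arbitrary: x)
  case 0
  have "tensor_square_prod Y (eta vac x) (- 2) (tensor_sym u v) \<in> C2_sym Y"
    unfolding C2_def using eta_fixed tensor_sym_fixed by (intro cvec.span_base) blast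
  then show ?case by (simp add: tensor_square_prod_eta)
next
  case (Suc j)
  have "Y (Y \<omega> 0 x) (- 2 - int j) w = of_nat (j + 2) *\<^sub>C Y x (- 2 - int (Suc j)) w" for w
    using translation[of x "- 2 - int j" w] by (simp add: algebra_simps)
  then have "tensor_sym (Y (Y \<omega> 0 x) (- 2 - int j) u) v + tensor_sym u (Y (Y \<omega> 0 x) (- 2 - int j) v)
    = of_nat (j + 2) *\<^sub>C
      (tensor_sym (Y x (- 2 - int (Suc j)) u) v + tensor_sym u (Y x (- 2 - int (Suc j)) v))"
    by (simp only: tensor_sym_def T_lin cvec.scale_right_distrib)
  with Suc[of "Y \<omega> 0 x"] have "of_nat (j + 2) *\<^sub>C
      (tensor_sym (Y x (- 2 - int (Suc j)) u) v + tensor_sym u (Y x (- 2 - int (Suc j)) v)) \<in> C2_sym Y"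
    by (simp only:)
  then have "(1 / of_nat (j + 2)) *\<^sub>C (of_nat (j + 2) *\<^sub>C
      (tensor_sym (Y x (- 2 - int (Suc j)) u) v + tensor_sym u (Y x (- 2 - int (Suc j)) v))) \<in> C2_sym Y"
    by (rule cvec.subspace_scale[OF csubspace_C2])
  moreover have "(1 / c) *\<^sub>C (c *\<^sub>C t) = t" if "c \<noteq> 0" for c and t :: "('v, 'v) tensor"
    using that by (simp add: cvec.scale_one)
  moreover have "of_nat (j + 2) \<noteq> (0 :: complex)" by (simp only: of_nat_eq_0_iff)
  ultimately show ?case by metis
qed

lemma eta_product_in_C2:
  assumes "simple_vertex_algebra Y" "CFT_type Y vac \<omega>"
  shows "\<exists>M. \<forall>m\<ge>M. eta vac (Y x (- int m) y) \<in> C2_sym Y"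
proof -
  obtain M where M: "\<forall>m\<ge>M. \<forall>\<phi>. coinvariant_form Y vac \<omega> \<phi> \<longrightarrow> \<phi> (Y x (- int m) y) vac = 0"
    using coinvariant_form_vanishes[OF assms] by blast
  have "eta vac (Y x (- int m) y) \<in> C2_sym Y" if "m \<ge> M" for m
  proof (rule ccontr)
    assume "\<not> ?thesis"
    then obtain \<xi> :: "('v, 'v) tensor \<Rightarrow> complex"
      where \<xi>: "\<And>s t. \<xi> (s + t) = \<xi> s + \<xi> t" "\<And>c s. \<xi> (c *\<^sub>C s) = c * \<xi> s"
        "\<And>w. w \<in> C2_sym Y \<Longrightarrow> \<xi> w = 0" "\<xi> (eta vac (Y x (- int m) y)) = 1"
      using ex_separating_functional[OF csubspace_C2] by blast
    have "coinvariant_form Y vac \<omega> (\<lambda>u v. \<xi> (tensor_sym u v))"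
    proof
      show "\<xi> (tensor_sym (Y z k u) v) = - \<xi> (tensor_sym u (Y z k v))" if "k \<le> - 2" for k z u v
      proof -
        have "k = - 2 - int (nat (- 2 - k))" using that by simp
        with tensor_sym_skew[of z "nat (- 2 - k)" u v] have
          "tensor_sym (Y z k u) v + tensor_sym u (Y z k v) \<in> C2_sym Y" by metis
        then have "\<xi> (tensor_sym (Y z k u) v) + \<xi> (tensor_sym u (Y z k v)) = 0"
          using \<xi>(1,3) by metis
        then show ?thesis by (rule eq_neg_iff_add_eq_0[THEN iffD2])
      qed
    qed (simp_all add: tensor_sym_def T_lin \<xi>(1,2) algebra_simps)
    then have "\<xi> (tensor_sym (Y x (- int m) y) vac) = 0" using M \<open>m \<ge> M\<close> by blast
    with \<xi>(4) show False by (simp add: tensor_sym_def eta_def)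
  qed
  then show ?thesis by blast
qed

end

theorem theorem4p3:
  fixes Y :: "'v::complex_vector \<Rightarrow> int \<Rightarrow> 'v \<Rightarrow> 'v" and vac \<omega> :: 'v
  assumes "vertex_operator_algebra Y vac \<omega>"
    and "simple_vertex_algebra Y"
    and "CFT_type Y vac \<omega>"
  shows "\<forall>x y. quotient_finite_dim (C2_sym Y) (D_space Y vac x y)"
proof (intro allI)
  fix x y
  interpret vertex_operator_algebra Y vac \<omega> by fact
  obtain M where M: "\<forall>m\<ge>M. eta vac (Y x (- int m) y) \<in> C2_sym Y"
    using eta_product_in_C2[OF assms(2,3)] by blast
  define S where "S = eta vac ` {Y x (- n) y | n. n > 0}"
  \<comment> \<open>Generators with n >= M have coset zero, so these finitely many already
    span.\<close>
  define S' where "S' = eta vac ` {Y x (- n) y | n. n > 0 \<and> n < int M}"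
  have "S' \<subseteq> S" by (auto simp: S_def S'_def)
  have D: "D_space Y vac x y = coset (C2_sym Y) ` cspan S"
  proof -
    have "{eta_bar Y vac (Y x (- n) y) | n. n > 0} = coset (C2_sym Y) ` S"
      by (auto simp: eta_bar_def S_def)
    then show ?thesis by (simp add: D_space_def quotient_span_cosets csubspace_C2)
  qed
  have "finite {Y x (- n) y | n. n > 0 \<and> n < int M}"
    by (rule finite_subset[of _ "(\<lambda>n. Y x (- n) y) ` {0<..<int M}"]) auto
  then have "finite (coset (C2_sym Y) ` S')" by (simp add: S'_def)
  moreover have "coset (C2_sym Y) ` S' \<subseteq> D_space Y vac x y"
    unfolding D using \<open>S' \<subseteq> S\<close> by (intro image_mono) (auto intro: cvec.span_base)
  moreover have "D_space Y vac x y = quotient_span (C2_sym Y) (coset (C2_sym Y) ` S')"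
  proof -
    have "\<exists>t\<in>cspan S'. coset (C2_sym Y) s = coset (C2_sym Y) t" if "s \<in> cspan S" for s
      using that
    proof (induction rule: cvec.span_induct_alt)
      case base
      show ?case using cvec.span_zero by blast
    next
      case (step c z s)
      then obtain t where t: "t \<in> cspan S'" "coset (C2_sym Y) s = coset (C2_sym Y) t" by blast
      have "\<exists>z'\<in>cspan S'. coset (C2_sym Y) z = coset (C2_sym Y) z'"
      proof -
        from step(1) obtain n where n: "n > 0" "z = eta vac (Y x (- n) y)" by (auto simp: S_def)
        show ?thesis
        proof (cases "n < int M")
          case True
          with n have "z \<in> S'" by (auto simp: S'_def)
          then show ?thesis using cvec.span_base by blast
        next
          case False
          then have "z \<in> C2_sym Y" using M[rule_format, of "nat n"] n by simp
          then have "coset (C2_sym Y) z = coset (C2_sym Y) 0"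
            by (rule coset_eq_coset_zero[OF csubspace_C2])
          then show ?thesis using cvec.span_zero by blast
        qed
      qed
      then obtain z' where z': "z' \<in> cspan S'" "coset (C2_sym Y) z = coset (C2_sym Y) z'" by blast
      have "coset (C2_sym Y) (c *\<^sub>C z + s) = coset (C2_sym Y) (c *\<^sub>C z' + t)"
        using t z' by (simp flip: coset_add_coset[OF csubspace_C2] coset_scale_coset[OF csubspace_C2])
      moreover have "c *\<^sub>C z' + t \<in> cspan S'" by (intro cvec.span_add cvec.span_scale t(1) z'(1))
      ultimately show ?case by blast
    qed
    then have "coset (C2_sym Y) ` cspan S \<subseteq> coset (C2_sym Y) ` cspan S'" by blast
    moreover have "coset (C2_sym Y) ` cspan S' \<subseteq> coset (C2_sym Y) ` cspan S"
      by (intro image_mono cvec.span_mono \<open>S' \<subseteq> S\<close>)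
    ultimately show ?thesis by (simp add: D quotient_span_cosets csubspace_C2)
  qed
  ultimately show "quotient_finite_dim (C2_sym Y) (D_space Y vac x y)"
    unfolding quotient_finite_dim_def by blast
qed

end
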